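(* Every linear ordering $L$ (countable, with universe $\omega$) has a $\Sigma_1$-generically c.e. copy and a $\Sigma_1$-coarsely c.e. copy.
   Context: Structures are countable with universe $\omega$ (substructures have universe a subset of $\omega$). A copy of a structure is a structure with universe $\omega$ isomorphic to it. Formulas are infinitary formulas of $\mathcal{L}_{\omega_1,\omega}$: $\Sigma_0=\Pi_0$ are the finitary quantifier-free formulas, and for $\alpha\ge 1$ a $\Sigma_\alpha$ formula is a countable disjunction of formulas $\exists \bar x\,\psi$ with $\psi\in\Pi_\beta$, $\beta<\alpha$ (dually for $\Pi_\alpha$). A substructure $\mathcal{B}$ of $\mathcal{A}$ is a $\Sigma_\alpha$ elementary substructure if for every $\Sigma_\alpha$ formula $\phi$ and every tuple $\bar b$ from $\mathcal{B}$, $\mathcal{B}\models\phi(\bar b)\iff\mathcal{A}\models\phi(\bar b)$. A set $D\subseteq\omega$ is dense if $\lim_{n\to\infty}|D\cap\{0,\dots,n\}|/(n+1)=1$. A c.e. substructure is one whose universe is c.e., each of whose relations (restricted to that universe) is c.e., and each of whose functions has c.e. graph. $\mathcal{A}$ is $\Sigma_\alpha$-generically c.e. if there is a dense c.e. set $D$ such that the substructure of $\mathcal{A}$ with universe $D$ is a c.e. substructure and a $\Sigma_\alpha$ elementary substructure of $\mathcal{A}$. $\mathcal{A}$ is $\Sigma_\alpha$-coarsely c.e. if there are a dense set $D$ and a c.e. structure $\mathcal{E}$ (universe $\omega$, relations c.e., graphs of functions c.e.) such that a structure $\mathcal{D}$ with universe $D$ is a $\Sigma_\alpha$ elementary substructure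 of both $\mathcal{A}$ and $\mathcal{E}$. *)

theory Defs
  imports Complex_Main
begin

section \<open>Computably enumerable relations\<close>

text \<open>
  Programs are evaluated on argument lists of any length, so no arities are attached to them.
  Restricted to the lists of a fixed length \<open>n\<close>, the functions computed are exactly the \<open>n\<close>-ary
  partial recursive functions.
\<close>

datatype recf =
    Zero
  | Succ
  | Proj nat
  | Comp recf "recf list"
  | PrimRec recf recf
  | Mu recf

inductive computes :: "recf \<Rightarrow> nat list \<Rightarrow> nat \<Rightarrow> bool" where
  "computes Zero xs 0"
| "computes Succ [x] (Suc x)"
| "i < length xs \<Longrightarrow> computes (Proj i) xs (xs ! i)"
| "list_all2 (\<lambda>g y. computes g xs y) gs ys \<Longrightarrow> computes f ys z \<Longrightarrow> computes (Comp f gs) xs z"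
| "computes f xs y \<Longrightarrow> computes (PrimRec f g) (0 # xs) y"
| "computes (PrimRec f g) (n # xs) y \<Longrightarrow> computes g (n # y # xs) z
    \<Longrightarrow> computes (PrimRec f g) (Suc n # xs) z"
| "computes f (n # xs) 0 \<Longrightarrow> (\<forall>k<n. \<exists>y. computes f (k # xs) (Suc y)) \<Longrightarrow> computes (Mu f) xs n"

definition ce_rel :: "nat \<Rightarrow> nat list set \<Rightarrow> bool" where
  "ce_rel n R \<longleftrightarrow>
     (\<forall>xs\<in>R. length xs = n) \<and>
     (\<exists>f. \<forall>xs. length xs = n \<longrightarrow> (xs \<in> R \<longleftrightarrow> (\<exists>y. computes f xs y)))"

definition ce_set :: "nat set \<Rightarrow> bool" where
  "ce_set D \<longleftrightarrow> ce_rel 1 {[x] |x. x \<in> D}"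

definition dense :: "nat set \<Rightarrow> bool" where
  "dense D \<longleftrightarrow> (\<lambda>n. real (card (D \<inter> {0..n})) / real (n + 1)) \<longlonglongrightarrow> 1"

section \<open>Structures\<close>

text \<open>
  Symbols of a countable language are natural numbers; a symbol belongs to the language iff it is
  given an arity. Constants are function symbols of arity 0.
\<close>

record lang =
  fun_ar :: "nat \<Rightarrow> nat option"
  rel_ar :: "nat \<Rightarrow> nat option"

text \<open>
  The values of \<^term>\<open>fn\<close> and \<^term>\<open>rl\<close> outside the universe, on lists of the wrong length, or at
  symbols outside the language, carry no meaning; all notions below ignore them.
\<close>

record struct =
  univ :: "nat set"
  fn :: "nat \<Rightarrow> nat list \<Rightarrow> nat"
  rl :: "nat \<Rightarrow> nat list set"

definition tuples :: "nat set \<Rightarrow> nat \<Rightarrow> nat list set" where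
  "tuples D n = {xs. length xs = n \<and> set xs \<subseteq> D}"

definition is_structure :: "lang \<Rightarrow> struct \<Rightarrow> bool" where
  "is_structure L A \<longleftrightarrow>
     (\<forall>f n. fun_ar L f = Some n \<longrightarrow> (\<forall>xs\<in>tuples (univ A) n. fn A f xs \<in> univ A))"

definition substructure :: "lang \<Rightarrow> struct \<Rightarrow> struct \<Rightarrow> bool" where
  "substructure L B A \<longleftrightarrow>
     is_structure L B \<and> is_structure L A \<and> univ B \<subseteq> univ A \<and>
     (\<forall>f n. fun_ar L f = Some n \<longrightarrow> (\<forall>xs\<in>tuples (univ B) n. fn B f xs = fn A f xs)) \<and>
     (\<forall>r n. rel_ar L r = Some n \<longrightarrow> (\<forall>xs\<in>tuples (univ B) n. xs \<in> rl B r \<longleftrightarrow> xs \<in> rl A r))"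

definition isomorphism :: "lang \<Rightarrow> (nat \<Rightarrow> nat) \<Rightarrow> struct \<Rightarrow> struct \<Rightarrow> bool" where
  "isomorphism L h A B \<longleftrightarrow>
     bij_betw h (univ A) (univ B) \<and>
     (\<forall>f n. fun_ar L f = Some n \<longrightarrow>
        (\<forall>xs\<in>tuples (univ A) n. h (fn A f xs) = fn B f (map h xs))) \<and>
     (\<forall>r n. rel_ar L r = Some n \<longrightarrow>
        (\<forall>xs\<in>tuples (univ A) n. xs \<in> rl A r \<longleftrightarrow> map h xs \<in> rl B r))"

definition is_copy :: "lang \<Rightarrow> struct \<Rightarrow> struct \<Rightarrow> bool" where
  "is_copy L A B \<longleftrightarrow> is_structure L B \<and> univ B = UNIV \<and> (\<exists>h. isomorphism L h A B)"

definition ce_structure :: "lang \<Rightarrow> struct \<Rightarrow> bool" where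
  "ce_structure L A \<longleftrightarrow>
     is_structure L A \<and> ce_set (univ A) \<and>
     (\<forall>r n. rel_ar L r = Some n \<longrightarrow> ce_rel n (rl A r \<inter> tuples (univ A) n)) \<and>
     (\<forall>f n. fun_ar L f = Some n \<longrightarrow>
        ce_rel (Suc n) {xs @ [fn A f xs] |xs. xs \<in> tuples (univ A) n})"

section \<open>Infinitary formulas\<close>

datatype tm = Var nat | App nat "tm list"

text \<open>
  \<open>FDisj I \<Phi>\<close> and \<open>FConj I \<Phi>\<close> are the disjunction and the conjunction of the formulas \<open>\<Phi> i\<close> for
  \<open>i \<in> I\<close>, where \<open>I\<close> may be empty, finite or infinite.
\<close>

datatype fm =
    FEq tm tm
  | FRel nat "tm list"
  | FNot fm
  | FConj "nat set" "nat \<Rightarrow> fm"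
  | FDisj "nat set" "nat \<Rightarrow> fm"
  | FEx nat fm
  | FAll nat fm

primrec wf_tm :: "lang \<Rightarrow> tm \<Rightarrow> bool" where
  "wf_tm L (Var x) \<longleftrightarrow> True"
| "wf_tm L (App f ts) \<longleftrightarrow> fun_ar L f = Some (length ts) \<and> list_all id (map (wf_tm L) ts)"

primrec wf_fm :: "lang \<Rightarrow> fm \<Rightarrow> bool" where
  "wf_fm L (FEq s t) \<longleftrightarrow> wf_tm L s \<and> wf_tm L t"
| "wf_fm L (FRel r ts) \<longleftrightarrow> rel_ar L r = Some (length ts) \<and> (\<forall>t\<in>set ts. wf_tm L t)"
| "wf_fm L (FNot \<phi>) \<longleftrightarrow> wf_fm L \<phi>"
| "wf_fm L (FConj I \<Phi>) \<longleftrightarrow> (\<forall>i\<in>I. wf_fm L (\<Phi> i))"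
| "wf_fm L (FDisj I \<Phi>) \<longleftrightarrow> (\<forall>i\<in>I. wf_fm L (\<Phi> i))"
| "wf_fm L (FEx x \<phi>) \<longleftrightarrow> wf_fm L \<phi>"
| "wf_fm L (FAll x \<phi>) \<longleftrightarrow> wf_fm L \<phi>"

primrec fv_tm :: "tm \<Rightarrow> nat set" where
  "fv_tm (Var x) = {x}"
| "fv_tm (App f ts) = \<Union> (set (map fv_tm ts))"

primrec fv :: "fm \<Rightarrow> nat set" where
  "fv (FEq s t) = fv_tm s \<union> fv_tm t"
| "fv (FRel r ts) = (\<Union>t\<in>set ts. fv_tm t)"
| "fv (FNot \<phi>) = fv \<phi>"
| "fv (FConj I \<Phi>) = (\<Union>i\<in>I. fv (\<Phi> i))"
| "fv (FDisj I \<Phi>) = (\<Union>i\<in>I. fv (\<Phi> i))"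
| "fv (FEx x \<phi>) = fv \<phi> - {x}"
| "fv (FAll x \<phi>) = fv \<phi> - {x}"

primrec eval_tm :: "struct \<Rightarrow> (nat \<Rightarrow> nat) \<Rightarrow> tm \<Rightarrow> nat" where
  "eval_tm A s (Var x) = s x"
| "eval_tm A s (App f ts) = fn A f (map (eval_tm A s) ts)"

primrec sat :: "struct \<Rightarrow> (nat \<Rightarrow> nat) \<Rightarrow> fm \<Rightarrow> bool" where
  "sat A s (FEq t u) \<longleftrightarrow> eval_tm A s t = eval_tm A s u"
| "sat A s (FRel r ts) \<longleftrightarrow> map (eval_tm A s) ts \<in> rl A r"
| "sat A s (FNot \<phi>) \<longleftrightarrow> \<not> sat A s \<phi>"
| "sat A s (FConj I \<Phi>) \<longleftrightarrow> (\<forall>i\<in>I. sat A s (\<Phi> i))"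
| "sat A s (FDisj I \<Phi>) \<longleftrightarrow> (\<exists>i\<in>I. sat A s (\<Phi> i))"
| "sat A s (FEx x \<phi>) \<longleftrightarrow> (\<exists>a\<in>univ A. sat A (s(x := a)) \<phi>)"
| "sat A s (FAll x \<phi>) \<longleftrightarrow> (\<forall>a\<in>univ A. sat A (s(x := a)) \<phi>)"

primrec finitary_qf :: "fm \<Rightarrow> bool" where
  "finitary_qf (FEq s t) \<longleftrightarrow> True"
| "finitary_qf (FRel r ts) \<longleftrightarrow> True"
| "finitary_qf (FNot \<phi>) \<longleftrightarrow> finitary_qf \<phi>"
| "finitary_qf (FConj I \<Phi>) \<longleftrightarrow> finite I \<and> (\<forall>i\<in>I. finitary_qf (\<Phi> i))"
| "finitary_qf (FDisj I \<Phi>) \<longleftrightarrow> finite I \<and> (\<forall>i\<in>I. finitary_qf (\<Phi> i))"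
| "finitary_qf (FEx x \<phi>) \<longleftrightarrow> False"
| "finitary_qf (FAll x \<phi>) \<longleftrightarrow> False"

text \<open>
  The levels of the hierarchy are indexed by the elements of a well-ordered type, whose least
  element \<^term>\<open>bot\<close> plays the role of the ordinal 0; for the finite levels take
  \<^typ>\<open>nat\<close>. The lists \<open>xs i\<close> are the quantified tuples.
\<close>

inductive is_Sigma :: "'o::{wellorder,order_bot} \<Rightarrow> fm \<Rightarrow> bool"
  and is_Pi :: "'o::{wellorder,order_bot} \<Rightarrow> fm \<Rightarrow> bool" where
  "finitary_qf \<phi> \<Longrightarrow> is_Sigma bot \<phi>"
| "finitary_qf \<phi> \<Longrightarrow> is_Pi bot \<phi>"
| "bot < \<alpha> \<Longrightarrow> (\<forall>i\<in>I. \<exists>\<beta><\<alpha>. is_Pi \<beta> (\<psi> i))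
    \<Longrightarrow> is_Sigma \<alpha> (FDisj I (\<lambda>i. foldr FEx (xs i) (\<psi> i)))"
| "bot < \<alpha> \<Longrightarrow> (\<forall>i\<in>I. \<exists>\<beta><\<alpha>. is_Sigma \<beta> (\<psi> i))
    \<Longrightarrow> is_Pi \<alpha> (FConj I (\<lambda>i. foldr FAll (xs i) (\<psi> i)))"

text \<open>
  A tuple \<open>bs\<close> is assigned to the variables \<open>0, \<dots>, length bs - 1\<close>, which must include all free
  variables of \<open>\<phi>\<close>; the value 0 of the remaining variables is irrelevant.
\<close>

definition sat_tuple :: "struct \<Rightarrow> fm \<Rightarrow> nat list \<Rightarrow> bool" where
  "sat_tuple A \<phi> bs \<longleftrightarrow> sat A (\<lambda>i. if i < length bs then bs ! i else 0) \<phi>"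

definition Sigma_elementary ::
  "lang \<Rightarrow> 'o::{wellorder,order_bot} \<Rightarrow> struct \<Rightarrow> struct \<Rightarrow> bool" where
  "Sigma_elementary L \<alpha> B A \<longleftrightarrow>
     substructure L B A \<and>
     (\<forall>\<phi> bs. wf_fm L \<phi> \<longrightarrow> is_Sigma \<alpha> \<phi> \<longrightarrow> set bs \<subseteq> univ B \<longrightarrow> fv \<phi> \<subseteq> {..<length bs} \<longrightarrow>
        (sat_tuple B \<phi> bs \<longleftrightarrow> sat_tuple A \<phi> bs))"

section \<open>Generically and coarsely c.e. structures\<close>

definition Sigma_generically_ce ::
  "lang \<Rightarrow> 'o::{wellorder,order_bot} \<Rightarrow> struct \<Rightarrow> bool" where
  "Sigma_generically_ce L \<alpha> A \<longleftrightarrow>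
     (\<exists>D. dense D \<and> ce_set D \<and>
        ce_structure L (A\<lparr>univ := D\<rparr>) \<and> Sigma_elementary L \<alpha> (A\<lparr>univ := D\<rparr>) A)"

definition Sigma_coarsely_ce ::
  "lang \<Rightarrow> 'o::{wellorder,order_bot} \<Rightarrow> struct \<Rightarrow> bool" where
  "Sigma_coarsely_ce L \<alpha> A \<longleftrightarrow>
     (\<exists>D E B. dense D \<and> ce_structure L E \<and> univ E = UNIV \<and> univ B = D \<and>
        Sigma_elementary L \<alpha> B A \<and> Sigma_elementary L \<alpha> B E)"

section \<open>Linear orderings\<close>

text \<open>The only symbol of the language is the binary relation symbol 0, read as \<open>\<le>\<close>.\<close>

definition order_lang :: lang where
  "order_lang = \<lparr>fun_ar = (\<lambda>_. None), rel_ar = [0 \<mapsto> 2]\<rparr>"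

definition linear_ordering :: "struct \<Rightarrow> bool" where
  "linear_ordering A \<longleftrightarrow>
     linear_order_on (univ A) {(x, y). x \<in> univ A \<and> y \<in> univ A \<and> [x, y] \<in> rl A 0}"

end

theory Submission
  imports Defs "HOL-Library.Infinite_Set"
begin

text \<open>
  Call a subset \<open>D\<close> of a linear order limit-dense if every point outside \<open>D\<close> is a limit of \<open>D\<close> from
  below or from above. Then every gap left by finitely many points of \<open>D\<close> that contains a point
  outside \<open>D\<close> contains infinitely many points of \<open>D\<close>, so a finite set of points can be moved into
  \<open>D\<close>, keeping its order and fixing those of its points that lie in \<open>D\<close>
  (\<open>embed_finite_limit_dense\<close>). A witness of an existential formula can therefore be replaced by one
  inside \<open>D\<close>, and \<open>D\<close> is a \<open>\<Sigma>\<^sub>1\<close> elementary substructure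
  (\<open>limit_dense_imp_Sigma_1_elementary\<close>).

  Every infinite linear order has a limit-dense subset of one of the order types \<open>\<omega>\<close>, \<open>\<zeta>\<close> (the
  integers), \<open>\<omega>\<cdot>\<omega>\<^sup>*\<close>, \<open>\<eta>\<close> (the rationals), or the reverse of one of them
  (\<open>limit_dense_embedding_exists\<close>). To see this, call two points far if infinitely many points lie
  between them; the points that are not far from a given point form its block, which is finite or of
  type \<open>\<omega>\<close>, \<open>\<omega>\<^sup>*\<close> or \<open>\<zeta>\<close>. If farness is a dense relation on some interval with far endpoints,
  that interval contains a limit-dense copy of the rationals. Otherwise between any two far points
  there are far \<open>u\<close> and \<open>v\<close> with no point far from both in between, so that the block of \<open>u\<close> is
  infinite above \<open>u\<close> or the block of \<open>v\<close> is infinite below \<open>v\<close>. Suppose some block is infinite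
  upwards. A descending sequence of such blocks gives \<open>\<omega>\<cdot>\<omega>\<^sup>*\<close>. If there is none, take a leftmost
  such block. Finitely many points on its left give \<open>\<omega>\<close>, and a block that is infinite on both sides
  gives \<open>\<zeta>\<close>. In the remaining case there are points far below it, and every interval from such a
  point up to the block contains a block infinite downwards, again strictly below the leftmost
  one; iterating this yields an ascending sequence of blocks infinite downwards, hence the reverse of
  \<open>\<omega>\<cdot>\<omega>\<^sup>*\<close>. The case of a block infinite downwards is the mirror image.

  All four types have decidable presentations, and generic computability of a copy concerns only the
  numbers in the chosen dense set. So a copy is obtained by putting the limit-dense subset on a decidable
  dense set \<open>D\<close> of numbers whose complement has the right cardinality, and the rest on the complement
  (\<open>copy_from_limit_dense_embedding\<close>). This copy is generically c.e. It is also coarsely c.e.: none of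
  the four types has a greatest element, so \<open>D\<close> stays limit-dense when the complement of \<open>D\<close>, in its
  natural order, is placed after \<open>D\<close> (before it, for the reversed types), and the resulting order on
  all numbers is decidable.
\<close>

section \<open>Recursive functions and decidable relations\<close>

lemma computes_deterministic:
  "computes f xs y \<Longrightarrow> computes f xs z \<Longrightarrow> y = z"
proof (induction arbitrary: z rule: computes.induct)
  case (1 xs)
  then show ?case by (cases rule: computes.cases) auto
next
  case (2 x)
  then show ?case by (cases rule: computes.cases) auto
next
  case (3 i xs)
  from 3(2) show ?case by (cases rule: computes.cases) auto
next
  case (4 xs gs ys f w)
  from 4(4) obtain ys' where ys': "list_all2 (\<lambda>g y. computes g xs y) gs ys'" "computes f ys' z"
    by (cases rule: computes.cases) auto
  have "ys = ys'"
    using 4(1) ys'(1) by (auto simp: list_all2_conv_all_nth intro!: nth_equalityI)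
  with ys' 4 show ?case by auto
next
  case (5 f xs y g)
  from 5(3) show ?case by (cases rule: computes.cases) (auto dest: 5(2))
next
  case (6 f g n xs y w)
  from 6(5) show ?case by (cases rule: computes.cases) (auto dest: 6(3) 6(4))
next
  case (7 f n xs)
  from 7(4) have z: "computes f (z # xs) 0" "\<forall>k<z. \<exists>y. computes f (k # xs) (Suc y)"
    by (cases rule: computes.cases; auto)+
  have "\<not> z < n" using 7(3) z(1) by fastforce
  moreover have "\<not> n < z" using 7(2) z(2) by fastforce
  ultimately show ?case by simp
qed

text \<open>
  Total functions on lists of a fixed length; this lets the closure properties below be stated for
  ordinary HOL terms in place of programs.
\<close>

definition recursive :: "nat \<Rightarrow> (nat list \<Rightarrow> nat) \<Rightarrow> bool" where
  "recursive n f \<longleftrightarrow> (\<exists>g. \<forall>xs. length xs = n \<longrightarrow> computes g xs (f xs))"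

lemma recursive_cong:
  "recursive n f \<Longrightarrow> (\<And>xs. length xs = n \<Longrightarrow> f xs = g xs) \<Longrightarrow> recursive n g"
  by (auto simp: recursive_def)

lemma recursive_zero: "recursive n (\<lambda>_. 0)"
  unfolding recursive_def by (blast intro: computes.intros)

lemma recursive_nth: "i < n \<Longrightarrow> recursive n (\<lambda>xs. xs ! i)"
  unfolding recursive_def by (blast intro: computes.intros)

lemma recursive_comp:
  assumes "recursive m f" "\<And>g. g \<in> set gs \<Longrightarrow> recursive n g" "length gs = m"
  shows "recursive n (\<lambda>xs. f (map (\<lambda>g. g xs) gs))"
proof -
  from assms(1) obtain p where p: "\<And>xs. length xs = m \<Longrightarrow> computes p xs (f xs)"
    by (auto simp: recursive_def)
  from assms(2) obtain q where
    q: "\<And>g xs. g \<in> set gs \<Longrightarrow> length xs = n \<Longrightarrow> computes (q g) xs (g xs)"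
    unfolding recursive_def by metis
  have "computes (Comp p (map q gs)) xs (f (map (\<lambda>g. g xs) gs))" if "length xs = n" for xs
    using that assms(3)
    by (intro computes.intros(4)[OF _ p]) (auto simp: list_all2_conv_all_nth q)
  then show ?thesis unfolding recursive_def by blast
qed

lemma recursive_Suc:
  assumes "recursive n f" shows "recursive n (\<lambda>xs. Suc (f xs))"
proof -
  have "recursive 1 (\<lambda>xs. Suc (xs ! 0))"
    unfolding recursive_def
    by (rule exI[of _ Succ]) (auto simp: length_Suc_conv intro: computes.intros)
  from recursive_comp[OF this, of "[f]" n] assms show ?thesis by simp
qed

lemma recursive_const: "recursive n (\<lambda>_. c)"
  by (induction c) (auto intro: recursive_zero recursive_Suc)

lemma recursive_rec:
  assumes "recursive n f" "recursive (Suc (Suc n)) g"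
  shows "recursive (Suc n) (\<lambda>xs. rec_nat (f (tl xs)) (\<lambda>k y. g (k # y # tl xs)) (hd xs))"
proof -
  from assms(1) obtain p where p: "\<And>xs. length xs = n \<Longrightarrow> computes p xs (f xs)"
    by (auto simp: recursive_def)
  from assms(2) obtain q where q: "\<And>xs. length xs = Suc (Suc n) \<Longrightarrow> computes q xs (g xs)"
    by (auto simp: recursive_def)
  have "computes (PrimRec p q) (k # xs) (rec_nat (f xs) (\<lambda>k y. g (k # y # xs)) k)"
    if "length xs = n" for k xs
  proof (induction k)
    case 0
    show ?case using p[OF that] by (simp add: computes.intros)
  next
    case (Suc k)
    show ?case using computes.intros(6)[OF Suc q] that by simp
  qed
  then show ?thesis
    unfolding recursive_def by (intro exI[of _ "PrimRec p q"]) (auto simp: length_Suc_conv)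
qed

lemma recursive_subst2:
  assumes "recursive 2 (\<lambda>xs. F (xs ! 0) (xs ! 1))" "recursive n f" "recursive n g"
  shows "recursive n (\<lambda>xs. F (f xs) (g xs))"
  using recursive_comp[OF assms(1), of "[f, g]" n] assms(2,3) by auto

text \<open>
  Primitive recursion on the first of two arguments, from which addition, multiplication,
  truncated subtraction and powers of two are obtained.
\<close>

lemma recursive_iterate2:
  assumes "recursive 1 (\<lambda>xs. f (xs ! 0))" "recursive 3 (\<lambda>xs. g (xs ! 0) (xs ! 1) (xs ! 2))"
  shows "recursive 2 (\<lambda>xs. rec_nat (f (xs ! 1)) (\<lambda>k y. g k y (xs ! 1)) (xs ! 0))"
proof (rule recursive_cong)
  have s: "Suc 1 = 2" "Suc 2 = 3" by simp_all
  show "recursive 2 (\<lambda>xs. rec_nat (f (tl xs ! 0))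
     (\<lambda>k y. (\<lambda>xs. g (xs ! 0) (xs ! 1) (xs ! 2)) (k # y # tl xs)) (hd xs))"
    by (rule recursive_rec[OF assms(1), of "\<lambda>xs. g (xs ! 0) (xs ! 1) (xs ! 2)", unfolded s,
        OF assms(2)])
qed (auto simp: length_Suc_conv numeral_2_eq_2)

lemma recursive_add:
  assumes "recursive n f" "recursive n g" shows "recursive n (\<lambda>xs. f xs + g xs)"
proof (rule recursive_subst2[OF _ assms])
  have "rec_nat b (\<lambda>k y. Suc y) a = a + b" for a b :: nat by (induction a) auto
  with recursive_iterate2[of "\<lambda>b. b" "\<lambda>k y b. Suc y"]
  show "recursive 2 (\<lambda>xs. xs ! 0 + xs ! 1)" by (simp add: recursive_nth recursive_Suc)
qed

lemma recursive_mult: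
  assumes "recursive n f" "recursive n g" shows "recursive n (\<lambda>xs. f xs * g xs)"
proof (rule recursive_subst2[OF _ assms])
  have "rec_nat 0 (\<lambda>k y. y + b) a = a * b" for a b :: nat by (induction a) auto
  with recursive_iterate2[of "\<lambda>b. 0" "\<lambda>k y b. y + b"]
  show "recursive 2 (\<lambda>xs. xs ! 0 * xs ! 1)"
    by (simp add: recursive_nth recursive_add recursive_const)
qed

lemma recursive_diff:
  assumes "recursive n f" "recursive n g" shows "recursive n (\<lambda>xs. f xs - g xs)"
proof -
  have "rec_nat 0 (\<lambda>k y. k) a = a - 1" for a :: nat by (induction a) auto
  with recursive_iterate2[of "\<lambda>b. 0" "\<lambda>k y b. k"]
  have "recursive 2 (\<lambda>xs. xs ! 0 - 1)" by (simp add: recursive_nth recursive_const)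
  then have pred: "recursive m (\<lambda>xs. h xs - 1)" if "recursive m h" for m h
    using recursive_subst2[of "\<lambda>a b. a - 1"] that by auto
  have "rec_nat b (\<lambda>k y. y - 1) a = b - a" for a b :: nat by (induction a) auto
  with recursive_iterate2[of "\<lambda>b. b" "\<lambda>k y b. y - 1"]
  have "recursive 2 (\<lambda>xs. xs ! 1 - xs ! 0)"
    by (simp add: recursive_nth pred[simplified])
  from recursive_subst2[OF this assms(2,1)] show ?thesis .
qed

lemma recursive_power2:
  assumes "recursive n f" shows "recursive n (\<lambda>xs. 2 ^ f xs)"
proof -
  have "rec_nat (Suc 0) (\<lambda>k y. y + y) a = 2 ^ a" for a :: nat by (induction a) auto
  with recursive_iterate2[of "\<lambda>b. Suc 0" "\<lambda>k y b. y + y"]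
  have "recursive 2 (\<lambda>xs. 2 ^ (xs ! 0))"
    by (simp add: recursive_nth recursive_add recursive_const)
  from recursive_subst2[OF this assms assms] show ?thesis .
qed

text \<open>
  The value 0 stands for truth, as this is what unbounded search looks for.
\<close>

definition decidable :: "nat \<Rightarrow> (nat list \<Rightarrow> bool) \<Rightarrow> bool" where
  "decidable n P \<longleftrightarrow> (\<exists>f. recursive n f \<and> (\<forall>xs. length xs = n \<longrightarrow> (P xs \<longleftrightarrow> f xs = 0)))"

lemma decidable_le:
  assumes "recursive n f" "recursive n g" shows "decidable n (\<lambda>xs. f xs \<le> g xs)"
  unfolding decidable_def
  by (rule exI[of _ "\<lambda>xs. f xs - g xs"]) (auto intro: recursive_diff assms)

lemma decidable_not:
  assumes "decidable n P" shows "decidable n (\<lambda>xs. \<not> P xs)"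
proof -
  from assms obtain f where "recursive n f" "\<forall>xs. length xs = n \<longrightarrow> (P xs \<longleftrightarrow> f xs = 0)"
    by (auto simp: decidable_def)
  then show ?thesis unfolding decidable_def
    by (intro exI[of _ "\<lambda>xs. 1 - f xs"]) (auto intro: recursive_diff recursive_const)
qed

lemma decidable_conj:
  assumes "decidable n P" "decidable n Q" shows "decidable n (\<lambda>xs. P xs \<and> Q xs)"
proof -
  from assms obtain f g where
    "recursive n f" "\<forall>xs. length xs = n \<longrightarrow> (P xs \<longleftrightarrow> f xs = 0)"
    "recursive n g" "\<forall>xs. length xs = n \<longrightarrow> (Q xs \<longleftrightarrow> g xs = 0)"
    by (auto simp: decidable_def)
  then show ?thesis unfolding decidable_def
    by (intro exI[of _ "\<lambda>xs. f xs + g xs"]) (auto intro: recursive_add)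
qed

lemma decidable_disj:
  assumes "decidable n P" "decidable n Q" shows "decidable n (\<lambda>xs. P xs \<or> Q xs)"
  using decidable_not[OF decidable_conj[OF assms[THEN decidable_not]]] by simp

lemma decidable_less:
  assumes "recursive n f" "recursive n g" shows "decidable n (\<lambda>xs. f xs < g xs)"
  using decidable_not[OF decidable_le[OF assms(2,1)]] by (simp add: not_le)

lemma decidable_eq:
  assumes "recursive n f" "recursive n g" shows "decidable n (\<lambda>xs. f xs = g xs)"
  using decidable_conj[OF decidable_le[OF assms] decidable_le[OF assms(2,1)]]
  by (simp add: order_eq_iff)

lemma decidable_subst2:
  assumes "decidable 2 (\<lambda>xs. P (xs ! 0) (xs ! 1))" "recursive n f" "recursive n g"
  shows "decidable n (\<lambda>xs. P (f xs) (g xs))"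
proof -
  from assms(1) obtain h where
    h: "recursive 2 h" "\<forall>xs. length xs = 2 \<longrightarrow> (P (xs ! 0) (xs ! 1) \<longleftrightarrow> h xs = 0)"
    by (auto simp: decidable_def)
  then have "recursive n (\<lambda>xs. h [f xs, g xs])"
    using recursive_comp[OF h(1), of "[f, g]" n] assms(2,3) by auto
  moreover have "P (f xs) (g xs) \<longleftrightarrow> h [f xs, g xs] = 0" for xs
    using h(2)[rule_format, of "[f xs, g xs]"] by simp
  ultimately show ?thesis unfolding decidable_def by blast
qed

lemma recursive_Least:
  assumes "decidable (Suc n) P" "\<And>xs. length xs = n \<Longrightarrow> \<exists>k. P (k # xs)"
  shows "recursive n (\<lambda>xs. LEAST k. P (k # xs))"
proof -
  from assms(1) obtain f where f: "recursive (Suc n) f"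
      "\<And>xs. length xs = Suc n \<Longrightarrow> P xs \<longleftrightarrow> f xs = 0"
    by (auto simp: decidable_def)
  then obtain p where p: "\<And>xs. length xs = Suc n \<Longrightarrow> computes p xs (f xs)"
    by (auto simp: recursive_def)
  have "computes (Mu p) xs (LEAST k. P (k # xs))" if "length xs = n" for xs
  proof (rule computes.intros(7))
    have "P ((LEAST k. P (k # xs)) # xs)" using assms(2)[OF that] by (rule LeastI_ex)
    then show "computes p ((LEAST k. P (k # xs)) # xs) 0"
      using p[of "(LEAST k. P (k # xs)) # xs"] f(2) that by simp
    show "\<forall>k<LEAST k. P (k # xs). \<exists>y. computes p (k # xs) (Suc y)"
    proof (intro allI impI)
      fix k assume "k < (LEAST k. P (k # xs))"
      then have "f (k # xs) \<noteq> 0" using not_less_Least f(2)[of "k # xs"] that by auto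
      then show "\<exists>y. computes p (k # xs) (Suc y)"
        using p[of "k # xs"] that by (cases "f (k # xs)") auto
    qed
  qed
  then show ?thesis unfolding recursive_def by blast
qed

text \<open>
  The program searches for a number on which the characteristic function, extended by a dummy first
  argument, vanishes. It stops at 0 on the relation, and diverges off it because programs are
  deterministic.
\<close>

lemma decidable_imp_ce_rel:
  assumes "decidable n P" shows "ce_rel n {xs. length xs = n \<and> P xs}"
proof -
  from assms obtain f where f: "recursive n f"
      "\<And>xs. length xs = n \<Longrightarrow> P xs \<longleftrightarrow> f xs = 0"
    by (auto simp: decidable_def)
  \<comment> \<open>The characteristic function with a dummy first argument.\<close>
  have "recursive (Suc n) (\<lambda>xs. f (map (\<lambda>g. g xs) (map (\<lambda>i xs. xs ! Suc i) [0..<n])))"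
    by (rule recursive_comp[OF f(1)]) (auto intro: recursive_nth)
  moreover have "map (\<lambda>g. g (k # xs)) (map (\<lambda>i xs. xs ! Suc i) [0..<length xs]) = xs"
    for k and xs :: "nat list" by (simp add: comp_def map_nth)
  ultimately obtain p where p: "\<And>k xs. length xs = n \<Longrightarrow> computes p (k # xs) (f xs)"
    unfolding recursive_def by (metis length_Cons)
  have "P xs \<longleftrightarrow> (\<exists>y. computes (Mu p) xs y)" if "length xs = n" for xs
  proof
    assume "P xs"
    then have "computes (Mu p) xs 0"
      using p[OF that, of 0] f(2)[OF that] by (intro computes.intros(7)) auto
    then show "\<exists>y. computes (Mu p) xs y" ..
  next
    assume "\<exists>y. computes (Mu p) xs y"
    then obtain y where "computes (Mu p) xs y" ..
    then have "computes p (y # xs) 0" by (cases rule: computes.cases) auto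
    then show "P xs" using computes_deterministic[OF p[OF that]] f(2)[OF that] by auto
  qed
  then show ?thesis unfolding ce_rel_def by auto
qed

lemma recursive_subst1:
  assumes "recursive 1 (\<lambda>xs. F (xs ! 0))" "recursive n f" shows "recursive n (\<lambda>xs. F (f xs))"
  using recursive_comp[OF assms(1), of "[f]" n] assms(2) by simp

lemma decidable_subst1:
  assumes "decidable 1 (\<lambda>xs. P (xs ! 0))" "recursive n f" shows "decidable n (\<lambda>xs. P (f xs))"
proof -
  from assms(1) obtain h where
    h: "recursive 1 h" "\<forall>xs. length xs = 1 \<longrightarrow> (P (xs ! 0) \<longleftrightarrow> h xs = 0)"
    by (auto simp: decidable_def)
  then have "recursive n (\<lambda>xs. h [f xs])"
    using recursive_comp[OF h(1), of "[f]" n] assms(2) by auto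
  moreover have "P (f xs) \<longleftrightarrow> h [f xs] = 0" for xs
    using h(2)[rule_format, of "[f xs]"] by simp
  ultimately show ?thesis unfolding decidable_def by blast
qed

lemma decidable_const: "decidable n (\<lambda>_. b)"
  unfolding decidable_def by (rule exI[of _ "\<lambda>_. if b then 0 else 1"]) (auto intro: recursive_const)

text \<open>
  The rank in \<open>D\<close> is computed by counting; on an infinite \<open>D\<close> it is the increasing bijection with the natural
  numbers, through which an order on the natural numbers is transported to \<open>D\<close>.
\<close>

lemma recursive_rank:
  assumes "decidable 1 (\<lambda>xs. xs ! 0 \<in> D)"
  shows "recursive 1 (\<lambda>xs. card {d\<in>D. d < xs ! 0})"
proof -
  from assms obtain h where
    h: "recursive 1 h" "\<And>xs. length xs = 1 \<Longrightarrow> xs ! 0 \<in> D \<longleftrightarrow> h xs = 0"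
    by (auto simp: decidable_def)
  have rank: "rec_nat 0 (\<lambda>k y. y + (1 - h [k])) n = card {d\<in>D. d < n}" for n
  proof (induction n)
    case (Suc n)
    have "{d\<in>D. d < Suc n} = (if n \<in> D then insert n {d\<in>D. d < n} else {d\<in>D. d < n})"
      by (auto simp: less_Suc_eq)
    then show ?case using Suc h(2)[of "[n]"] by (cases "h [n]") auto
  qed simp
  have "recursive (Suc (Suc 0)) (\<lambda>xs. xs ! 1 + (1 - h [xs ! 0]))"
  proof (intro recursive_add recursive_diff recursive_const recursive_nth)
    show "recursive (Suc (Suc 0)) (\<lambda>xs. h [xs ! 0])"
      using recursive_comp[OF h(1), of "[\<lambda>xs. xs ! 0]" "Suc (Suc 0)"] by (simp add: recursive_nth)
  qed simp
  from recursive_rec[OF recursive_const this, of 0]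
  have "recursive (Suc 0) (\<lambda>xs. card {d\<in>D. d < hd xs})" by (simp add: rank[simplified])
  then show ?thesis unfolding One_nat_def by (rule recursive_cong) (auto simp: length_Suc_conv)
qed

lemma decidable_imp_ce_order:
  assumes D: "decidable 1 (\<lambda>xs. xs ! 0 \<in> univ A)"
    and R: "decidable 2 (\<lambda>xs. R (xs ! 0) (xs ! 1))"
    and eq: "\<And>x y. x \<in> univ A \<Longrightarrow> y \<in> univ A \<Longrightarrow> [x, y] \<in> rl A 0 \<longleftrightarrow> R x y"
  shows "ce_set (univ A)" "ce_structure order_lang A"
proof -
  have "{[x] |x. x \<in> univ A} = {xs. length xs = 1 \<and> xs ! 0 \<in> univ A}"
    by (auto simp: length_Suc_conv)
  with decidable_imp_ce_rel[OF D] show ce: "ce_set (univ A)" by (simp add: ce_set_def)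
  have eq_set: "rl A 0 \<inter> tuples (univ A) 2 =
      {xs. length xs = 2 \<and> (xs ! 0 \<in> univ A \<and> xs ! 1 \<in> univ A \<and> R (xs ! 0) (xs ! 1))}"
    by (auto simp: tuples_def length_Suc_conv numeral_2_eq_2 eq)
  have "decidable 2 (\<lambda>xs. xs ! 0 \<in> univ A \<and> xs ! 1 \<in> univ A \<and> R (xs ! 0) (xs ! 1))"
    by (intro decidable_conj R decidable_subst1[OF D] recursive_nth) auto
  from decidable_imp_ce_rel[OF this] have "ce_rel 2 (rl A 0 \<inter> tuples (univ A) 2)"
    unfolding eq_set .
  with ce show "ce_structure order_lang A"
    by (auto simp: ce_structure_def is_structure_def order_lang_def split: if_splits)
qed

section \<open>Limit-dense subsets of a linear order\<close>

context linorder
begin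

text \<open>
  If \<open>y\<close> is a limit from below, the points of \<open>D\<close> below \<open>y\<close> are nonempty without a maximum. The
  definition asks for this or its mirror image, which covers all gaps around \<open>y\<close> at once and
  involves no cardinalities.
\<close>

definition limit_dense :: "'a set \<Rightarrow> bool" where
  "limit_dense D \<longleftrightarrow> (\<forall>y. y \<notin> D \<longrightarrow>
     ((\<exists>d\<in>D. d < y) \<and> (\<forall>a\<in>D. a < y \<longrightarrow> (\<exists>d\<in>D. a < d \<and> d < y))) \<or>
     ((\<exists>d\<in>D. y < d) \<and> (\<forall>a\<in>D. y < a \<longrightarrow> (\<exists>d\<in>D. y < d \<and> d < a))))"

lemma exists_above_finite:
  assumes "finite H" "T \<noteq> {}" "\<And>t. t \<in> T \<Longrightarrow> \<exists>t'\<in>T. t < t'" "H \<subseteq> T"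
  shows "\<exists>t\<in>T. \<forall>h\<in>H. h < t"
  using assms(1,4)
proof (induction rule: finite_induct)
  case empty
  then show ?case using assms(2) by blast
next
  case (insert x F)
  then obtain t where t: "t \<in> T" "\<forall>h\<in>F. h < t" by auto
  from insert assms(3) obtain x' where x': "x' \<in> T" "x < x'" by blast
  have "max x' t \<in> T" using t x' by (auto simp: max_def)
  moreover have "\<forall>h\<in>insert x F. h < max x' t" using t x' by (auto simp: less_max_iff_disj)
  ultimately show ?case by blast
qed

text \<open>
  By induction along the finite set: the image of the next point is chosen above all previous ones.
\<close>

lemma embed_finite_no_max:
  assumes "finite H" "T \<noteq> {}" "\<And>t. t \<in> T \<Longrightarrow> \<exists>t'\<in>T. t < t'"
  shows "\<exists>k. k ` H \<subseteq> T \<and> (\<forall>x\<in>H. \<forall>y\<in>H. x < y \<longrightarrow> k x < k y)"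
  using assms(1)
proof (induction rule: finite_linorder_max_induct)
  case empty
  then show ?case by auto
next
  case (insert b A)
  then obtain k where k: "k ` A \<subseteq> T" "\<forall>x\<in>A. \<forall>y\<in>A. x < y \<longrightarrow> k x < k y" by blast
  obtain t where t: "t \<in> T" "\<forall>h\<in>k ` A. h < t"
    using exists_above_finite[OF _ assms(2,3) k(1)] insert.hyps(1) by blast
  have "(k(b := t)) ` insert b A \<subseteq> T" using k(1) t(1) by auto
  moreover have "\<forall>x\<in>insert b A. \<forall>y\<in>insert b A. x < y \<longrightarrow> (k(b := t)) x < (k(b := t)) y"
    using k(2) t(2) insert.hyps(2) by (auto dest: less_asym)
  ultimately show ?case by blast
qed

text \<open>
  \<open>z\<close> lies in the same gap of \<open>F\<close> as \<open>y\<close>.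
\<close>

definition same_cut :: "'a set \<Rightarrow> 'a \<Rightarrow> 'a \<Rightarrow> bool" where
  "same_cut F y z \<longleftrightarrow> (\<forall>f\<in>F. (f < z \<longleftrightarrow> f < y) \<and> (z < f \<longleftrightarrow> y < f))"

text \<open>
  The points of \<open>D\<close> that lie below \<open>y\<close> in the gap of \<open>y\<close> are nonempty without a maximum, so they
  accommodate any finite chain.
\<close>

lemma embed_gap_below:
  assumes "finite F" "F \<subseteq> D" "y \<notin> D" "finite H"
    "\<exists>d\<in>D. d < y" "\<forall>a\<in>D. a < y \<longrightarrow> (\<exists>d\<in>D. a < d \<and> d < y)"
  shows "\<exists>k. k ` H \<subseteq> {d\<in>D. same_cut F y d} \<and> (\<forall>x\<in>H. \<forall>z\<in>H. x < z \<longrightarrow> k x < k z)"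
proof -
  let ?T = "{d\<in>D. same_cut F y d \<and> d < y}"
  have "\<exists>t\<in>{d\<in>D. d < y}. \<forall>h\<in>{f\<in>F. f < y}. h < t"
    using assms by (intro exists_above_finite) auto
  then obtain t where t: "t \<in> D" "t < y" "\<forall>h\<in>F. h < y \<longrightarrow> h < t" by auto
  have "same_cut F y t" unfolding same_cut_def
  proof (intro ballI conjI)
    fix f assume f: "f \<in> F"
    with assms have "f \<noteq> y" by blast
    then consider "f < y" | "y < f" using less_linear by blast
    then have "(f < t) = (f < y) \<and> (t < f) = (y < f)"
      using f t by cases (auto dest: less_trans less_asym)
    then show "(f < t) = (f < y)" "(t < f) = (y < f)" by blast+
  qed
  with t have ne: "?T \<noteq> {}" by blast
  have "\<exists>t'\<in>?T. t < t'" if "t \<in> ?T" for t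
  proof -
    from that assms(6) obtain d where d: "d \<in> D" "t < d" "d < y" by auto
    have "same_cut F y d"
      unfolding same_cut_def
    proof (intro ballI)
      fix f assume "f \<in> F"
      with that have "(f < t) = (f < y)" "(t < f) = (y < f)" unfolding same_cut_def by blast+
      with d show "(f < d) = (f < y) \<and> (d < f) = (y < f)"
        by (auto intro: less_trans)
    qed
    with d show ?thesis by blast
  qed
  then obtain k where "k ` H \<subseteq> ?T" "\<forall>x\<in>H. \<forall>z\<in>H. x < z \<longrightarrow> k x < k z"
    using embed_finite_no_max[OF assms(4) ne] by blast
  moreover from this have "k ` H \<subseteq> {d\<in>D. same_cut F y d}" by blast
  ultimately show ?thesis by blast
qed

text \<open>
  Notions of the reversed order are rewritten in terms of the given one, so that a fact proved on one
  side of a point transfers to the other.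
\<close>

lemma dual_same_cut: "linorder.same_cut (\<lambda>x y. y < x) F y z = same_cut F y z"
  unfolding same_cut_def linorder.same_cut_def[OF dual_linorder] by auto

lemma embed_gap:
  assumes "limit_dense D" "finite F" "F \<subseteq> D" "y \<notin> D" "finite H"
  shows "\<exists>k. k ` H \<subseteq> {d\<in>D. same_cut F y d} \<and> (\<forall>x\<in>H. \<forall>z\<in>H. x < z \<longrightarrow> k x < k z)"
proof -
  from assms(1,4) consider
    "\<exists>d\<in>D. d < y" "\<forall>a\<in>D. a < y \<longrightarrow> (\<exists>d\<in>D. a < d \<and> d < y)" |
    "\<exists>d\<in>D. y < d" "\<forall>a\<in>D. y < a \<longrightarrow> (\<exists>d\<in>D. d < a \<and> y < d)"
    unfolding limit_dense_def by blast
  then show ?thesis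
  proof cases
    case 1
    from embed_gap_below[OF assms(2-5) this] show ?thesis .
  next
    case 2
    from linorder.embed_gap_below[OF dual_linorder assms(2-5) this]
    show ?thesis unfolding dual_same_cut by blast
  qed
qed

lemma same_cut_convex:
  assumes "same_cut F y x" "same_cut F y w" "\<not> same_cut F y z"
  shows "x < z \<longleftrightarrow> w < z" "z < x \<longleftrightarrow> z < w"
proof -
  from assms(3) obtain f where f: "f \<in> F" "(f < z) \<noteq> (f < y) \<or> (z < f) \<noteq> (y < f)"
    unfolding same_cut_def by blast
  with assms(1,2) have
    "(f < x) = (f < y)" "(x < f) = (y < f)" "(f < w) = (f < y)" "(w < f) = (y < f)"
    unfolding same_cut_def by blast+
  with f(2) consider "f < z" "\<not> f < x" "\<not> f < w" | "\<not> f < z" "f < x" "f < w"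
    | "z < f" "\<not> x < f" "\<not> w < f" | "\<not> z < f" "x < f" "w < f"
    by blast
  then have "x < z \<and> w < z \<or> z < x \<and> z < w"
    by cases (auto simp: not_less dest: less_le_trans le_less_trans)
  then show "x < z \<longleftrightarrow> w < z" "z < x \<longleftrightarrow> z < w"
    by (auto dest: less_asym)
qed

text \<open>
  The points of \<open>G\<close> in \<open>D\<close> cut the order into gaps. As long as some point of \<open>G\<close> lies outside \<open>D\<close>,
  all of \<open>G\<close> in the gap of that point is moved into \<open>D\<close> without leaving the gap; this keeps the order
  of \<open>G\<close> and lowers the number of points outside \<open>D\<close>.
\<close>

lemma embed_finite_limit_dense:
  assumes "limit_dense D" "finite G"
  shows "\<exists>g. (\<forall>x\<in>G \<inter> D. g x = x) \<and> g ` G \<subseteq> D \<and> (\<forall>x\<in>G. \<forall>y\<in>G. x < y \<longrightarrow> g x < g y)"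
  using assms(2)
proof (induction "card (G - D)" arbitrary: G rule: less_induct)
  case less
  show ?case
  proof (cases "G \<subseteq> D")
    case True
    then show ?thesis by (intro exI[of _ "\<lambda>x. x"]) auto
  next
    case False
    then obtain y where y: "y \<in> G" "y \<notin> D" by blast
    define F where "F = G \<inter> D"
    define H where "H = {x\<in>G. same_cut F y x}"
    have fin: "finite F" "finite H" "F \<subseteq> D" using less.prems by (auto simp: F_def H_def)
    obtain k where k: "k ` H \<subseteq> {d\<in>D. same_cut F y d}"
      "\<forall>x\<in>H. \<forall>z\<in>H. x < z \<longrightarrow> k x < k z"
      using embed_gap[OF assms(1) fin(1,3) y(2) fin(2)] by blast
    define g where "g x = (if x \<in> H then k x else x)" for x
    have "x \<notin> H" if "x \<in> F" for x
    proof -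
      have "x < y \<or> y < x" using that y less_linear[of x y] by (auto simp: F_def)
      with that show ?thesis by (auto simp: H_def same_cut_def)
    qed
    then have fix_g: "g x = x" if "x \<in> F" for x using that by (auto simp: g_def)
    have mono_g: "g x < g z" if "x \<in> G" "z \<in> G" "x < z" for x z
    proof -
      have "k w \<in> {d\<in>D. same_cut F y d}" if "w \<in> H" for w using k(1) that by blast
      then show ?thesis
        using that k(2) same_cut_convex[of F y] unfolding g_def H_def by auto
    qed
    have "g ` G - D \<subseteq> (G - D) - {y}"
      using y k(1) by (auto simp: g_def H_def same_cut_def)
    moreover have "y \<in> G - D" using y by blast
    ultimately have "card (g ` G - D) < card (G - D)"
      using less.prems by (intro psubset_card_mono) auto
    from less.hyps[OF this finite_imageI[OF less.prems]] obtain h where h: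
      "\<forall>x\<in>g ` G \<inter> D. h x = x" "h ` g ` G \<subseteq> D"
      "\<forall>x\<in>g ` G. \<forall>y\<in>g ` G. x < y \<longrightarrow> h x < h y"
      by (elim exE conjE)
    have "h (g x) = x" if "x \<in> G \<inter> D" for x
    proof -
      have "g x = x" using fix_g that by (simp add: F_def)
      moreover have "g x \<in> g ` G" using that by blast
      ultimately show ?thesis using h(1) that by auto
    qed
    moreover have "(h \<circ> g) ` G \<subseteq> D" using h(2) by auto
    ultimately show ?thesis
      using h(3) mono_g by (intro exI[of _ "h \<circ> g"]) auto
  qed
qed

end

section \<open>Limit-dense subsets are elementary for existential formulas\<close>

lemma sat_foldr_FEx:
  "sat A s (foldr FEx xs \<psi>) \<longleftrightarrow>
   (\<exists>s'. (\<forall>i. i \<notin> set xs \<longrightarrow> s' i = s i) \<and> (\<forall>i\<in>set xs. s' i \<in> univ A) \<and> sat A s' \<psi>)"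
proof (induction xs arbitrary: s)
  case Nil
  have "s' = s" if "\<forall>i. s' i = s i" for s' :: "nat \<Rightarrow> nat" using that by blast
  then show ?case by auto
next
  case (Cons x xs)
  show ?case
  proof
    assume "sat A s (foldr FEx (x # xs) \<psi>)"
    then obtain a s' where "a \<in> univ A" "\<forall>i. i \<notin> set xs \<longrightarrow> s' i = (s(x := a)) i"
      "\<forall>i\<in>set xs. s' i \<in> univ A" "sat A s' \<psi>"
      unfolding foldr.simps comp_def sat.simps Cons.IH by blast
    then show "\<exists>s'. (\<forall>i. i \<notin> set (x # xs) \<longrightarrow> s' i = s i) \<and>
      (\<forall>i\<in>set (x # xs). s' i \<in> univ A) \<and> sat A s' \<psi>"
      by (intro exI[of _ s']) (cases "x \<in> set xs"; auto)
  next
    assume "\<exists>s'. (\<forall>i. i \<notin> set (x # xs) \<longrightarrow> s' i = s i) \<and>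
      (\<forall>i\<in>set (x # xs). s' i \<in> univ A) \<and> sat A s' \<psi>"
    then obtain s' where s': "\<forall>i. i \<notin> set (x # xs) \<longrightarrow> s' i = s i"
      "\<forall>i\<in>set (x # xs). s' i \<in> univ A" "sat A s' \<psi>" by blast
    then have "\<forall>i. i \<notin> set xs \<longrightarrow> s' i = (s(x := s' x)) i" by auto
    with s' show "sat A s (foldr FEx (x # xs) \<psi>)"
      unfolding foldr.simps comp_def sat.simps Cons.IH
      by (intro bexI[of _ "s' x"] exI[of _ s']) auto
  qed
qed

lemma fv_foldr_FEx: "fv (foldr FEx xs \<psi>) = fv \<psi> - set xs"
  by (induction xs) auto

lemma wf_fm_foldr_FEx: "wf_fm L (foldr FEx xs \<psi>) \<longleftrightarrow> wf_fm L \<psi>"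
  by (induction xs) auto

lemma is_Sigma_1_cases:
  assumes "is_Sigma (1::nat) \<phi>"
  obtains I xs \<psi> where "\<phi> = FDisj I (\<lambda>i. foldr FEx (xs i) (\<psi> i))"
    "\<forall>i\<in>I. finitary_qf (\<psi> i)"
  using assms
proof (cases rule: is_Sigma.cases)
  case 1
  then show ?thesis by (simp add: bot_nat_def)
next
  case (2 I \<psi> xs)
  have "finitary_qf (\<psi> i)" if "i \<in> I" for i
  proof -
    from 2(3) that have "is_Pi (0::nat) (\<psi> i)" by auto
    then show ?thesis by (cases rule: is_Pi.cases) (auto simp: bot_nat_def)
  qed
  with 2(1) show ?thesis by (intro that) auto
qed

lemma wf_tm_order_lang: "wf_tm order_lang t \<Longrightarrow> \<exists>x. t = Var x"
  by (cases t) (auto simp: order_lang_def)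

lemma sat_qf_order_iso:
  assumes "finitary_qf \<psi>" "wf_fm order_lang \<psi>"
    "\<And>i j. i \<in> fv \<psi> \<Longrightarrow> j \<in> fv \<psi> \<Longrightarrow> s i = s j \<longleftrightarrow> t i = t j"
    "\<And>i j. i \<in> fv \<psi> \<Longrightarrow> j \<in> fv \<psi> \<Longrightarrow> [s i, s j] \<in> rl A 0 \<longleftrightarrow> [t i, t j] \<in> rl B 0"
  shows "sat A s \<psi> \<longleftrightarrow> sat B t \<psi>"
  using assms
proof (induction \<psi>)
  case (FEq u v)
  then obtain x y where "u = Var x" "v = Var y"
    using wf_tm_order_lang by (metis wf_fm.simps(1))
  with FEq show ?case by simp
next
  case (FRel r ts)
  then have "length ts = 2" "r = 0" "\<forall>t\<in>set ts. \<exists>x. t = Var x"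
    using wf_tm_order_lang by (auto simp: order_lang_def split: if_splits)
  then obtain x y where "ts = [Var x, Var y]" by (auto simp: numeral_2_eq_2 length_Suc_conv)
  with \<open>r = 0\<close> FRel show ?case by simp
next
  case (FConj I \<Phi>)
  have "sat A s (\<Phi> i) \<longleftrightarrow> sat B t (\<Phi> i)" if "i \<in> I" for i
    using FConj.prems(1,2) that by (intro FConj.IH FConj.prems(3,4)) auto
  then show ?case by simp
next
  case (FDisj I \<Phi>)
  have "sat A s (\<Phi> i) \<longleftrightarrow> sat B t (\<Phi> i)" if "i \<in> I" for i
    using FDisj.prems(1,2) that by (intro FDisj.IH FDisj.prems(3,4)) auto
  then show ?case by simp
qed auto

text \<open>
  Finitary quantifier-free formulas only see the order of the values of their variables. So a witness
  found in the large structure is moved into the substructure together with the parameters,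
  which stay fixed because they already lie there; this works for each member of the infinitary
  disjunction separately.
\<close>

lemma limit_dense_imp_Sigma_1_elementary:
  assumes lin: "class.linorder (\<lambda>x y. [x, y] \<in> rl A 0) lt"
    and D: "linorder.limit_dense lt (univ B)"
    and A: "univ A = UNIV"
    and eq: "\<And>x y. x \<in> univ B \<Longrightarrow> y \<in> univ B \<Longrightarrow> [x, y] \<in> rl B 0 \<longleftrightarrow> [x, y] \<in> rl A 0"
  shows "Sigma_elementary order_lang (1::nat) B A"
  unfolding Sigma_elementary_def
proof (intro conjI allI impI)
  show "substructure order_lang B A"
    unfolding substructure_def is_structure_def using A eq
    by (auto simp: order_lang_def tuples_def numeral_2_eq_2 length_Suc_conv split: if_splits)
next
  interpret lo: linorder "\<lambda>x y. [x, y] \<in> rl A 0" lt by (rule lin)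
  fix \<phi> bs
  assume wf: "wf_fm order_lang \<phi>" and Sig: "is_Sigma (1::nat) \<phi>"
    and bs: "set bs \<subseteq> univ B" and fv: "fv \<phi> \<subseteq> {..<length bs}"
  from Sig obtain I xs \<psi> where \<phi>: "\<phi> = FDisj I (\<lambda>i. foldr FEx (xs i) (\<psi> i))"
    and "\<forall>i\<in>I. finitary_qf (\<psi> i)" by (elim is_Sigma_1_cases)
  then have qf: "finitary_qf (\<psi> i)" if "i \<in> I" for i using that by blast
  define s where "s = (\<lambda>i. if i < length bs then bs ! i else 0)"
  have s: "s i \<in> univ B" if "i < length bs" for i
    using bs that by (auto simp: s_def)
  have "sat B s (foldr FEx (xs i) (\<psi> i)) \<longleftrightarrow> sat A s (foldr FEx (xs i) (\<psi> i))" if i: "i \<in> I" for i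
  proof -
    have wf_i: "wf_fm order_lang (\<psi> i)" using wf i by (simp add: \<phi> wf_fm_foldr_FEx)
    have fv_i: "j < length bs" if "j \<in> fv (\<psi> i)" "j \<notin> set (xs i)" for j
      using that fv i by (auto simp: \<phi> fv_foldr_FEx)
    show ?thesis
    proof
      assume "sat B s (foldr FEx (xs i) (\<psi> i))"
      then obtain s' where s': "\<forall>j. j \<notin> set (xs i) \<longrightarrow> s' j = s j"
        "\<forall>j\<in>set (xs i). s' j \<in> univ B" "sat B s' (\<psi> i)"
        unfolding sat_foldr_FEx by blast
      have "s' j \<in> univ B" if "j \<in> fv (\<psi> i)" for j
        using s'(1,2) s fv_i that by (cases "j \<in> set (xs i)") auto
      then have "sat A s' (\<psi> i)"
        using s'(3) eq sat_qf_order_iso[OF qf[OF i] wf_i, of s' s' B A] by blast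
      with s'(1) A show "sat A s (foldr FEx (xs i) (\<psi> i))"
        unfolding sat_foldr_FEx by auto
    next
      assume "sat A s (foldr FEx (xs i) (\<psi> i))"
      then obtain s' where s': "\<forall>j. j \<notin> set (xs i) \<longrightarrow> s' j = s j" "sat A s' (\<psi> i)"
        unfolding sat_foldr_FEx by blast
      define G where "G = s' ` (set (xs i) \<union> {..<length bs})"
      have "finite G" by (simp add: G_def)
      from lo.embed_finite_limit_dense[OF D this] obtain g where
        g: "\<forall>x\<in>G \<inter> univ B. g x = x" "g ` G \<subseteq> univ B" "\<forall>x\<in>G. \<forall>y\<in>G. lt x y \<longrightarrow> lt (g x) (g y)"
        by (elim exE conjE)
      have G: "s' j \<in> G" if "j \<in> fv (\<psi> i)" for j
        using fv_i that by (auto simp: G_def)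
      have g_eq: "x = y \<longleftrightarrow> g x = g y"
        and g_le: "[x, y] \<in> rl A 0 \<longleftrightarrow> [g x, g y] \<in> rl B 0" if xy: "x \<in> G" "y \<in> G" for x y
      proof -
        have e: "[g x, g y] \<in> rl B 0 \<longleftrightarrow> [g x, g y] \<in> rl A 0"
          using xy g(2) by (intro eq) auto
        consider "lt x y" "lt (g x) (g y)" | "x = y" | "lt y x" "lt (g y) (g x)"
          using g(3) xy lo.less_linear[of x y] by blast
        then have "(x = y \<longleftrightarrow> g x = g y) \<and> ([x, y] \<in> rl A 0 \<longleftrightarrow> [g x, g y] \<in> rl A 0)"
          by cases (auto simp: lo.less_le_not_le)
        with e show "x = y \<longleftrightarrow> g x = g y" "[x, y] \<in> rl A 0 \<longleftrightarrow> [g x, g y] \<in> rl B 0"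
          by blast+
      qed
      define t where "t = (\<lambda>j. if j \<in> set (xs i) then g (s' j) else s j)"
      have t: "t j = g (s' j)" if j: "j \<in> fv (\<psi> i)" for j
      proof (cases "j \<in> set (xs i)")
        case False
        then have "s' j \<in> G \<inter> univ B" using G[OF j] s'(1) s[OF fv_i[OF j]] by auto
        with False s'(1) g(1) show ?thesis by (auto simp: t_def)
      qed (simp add: t_def)
      have "sat A s' (\<psi> i) \<longleftrightarrow> sat B t (\<psi> i)"
        using g_eq g_le G by (intro sat_qf_order_iso[OF qf[OF i] wf_i]) (simp_all add: t)
      with s' have "sat B t (\<psi> i)" by simp
      moreover have "\<forall>j\<in>set (xs i). t j \<in> univ B"
        using g(2) by (auto simp: t_def G_def)
      ultimately show "sat B s (foldr FEx (xs i) (\<psi> i))"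
        unfolding sat_foldr_FEx by (intro exI[of _ t]) (auto simp: t_def)
    qed
  qed
  then show "sat_tuple B \<phi> bs \<longleftrightarrow> sat_tuple A \<phi> bs"
    by (simp add: sat_tuple_def \<phi> flip: s_def)
qed

section \<open>Four decidable linear orders on the natural numbers\<close>

text \<open>
  The binary logarithm, rounded down, with value 0 at 0.
\<close>

definition lg :: "nat \<Rightarrow> nat" where
  "lg n = (LEAST k. n < 2 ^ Suc k)"

text \<open>
  Every value is attained infinitely often, and 0 only on a sparse set.
\<close>

definition offset :: "nat \<Rightarrow> nat" where
  "offset n = n - 2 ^ lg n"

lemma less_power_Suc_lg: "n < 2 ^ Suc (lg n)"
  unfolding lg_def by (rule LeastI[of _ n]) (use less_exp[of "Suc n"] in simp)

lemma lg_eq: "2 ^ k \<le> n \<Longrightarrow> n < 2 ^ Suc k \<Longrightarrow> lg n = k"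
  unfolding lg_def
proof (rule Least_equality)
  fix j assume "2 ^ k \<le> n" "n < 2 ^ Suc j"
  then have "(2::nat) ^ k < 2 ^ Suc j" by simp
  then show "k \<le> j" using power_less_imp_less_exp[of "2::nat" k "Suc j"] by simp
qed

lemma power_lg_le: "n > 0 \<Longrightarrow> 2 ^ lg n \<le> n"
proof (cases "lg n")
  case (Suc k)
  then have "\<not> n < 2 ^ Suc k" using not_less_Least[of k "\<lambda>k. n < 2 ^ Suc k"] by (simp add: lg_def)
  with Suc show ?thesis by simp
qed simp

lemma offset_eq: "i < 2 ^ k \<Longrightarrow> offset (2 ^ k + i) = i"
  using lg_eq[of k "2 ^ k + i"] by (simp add: offset_def)

lemma infinite_offset_eq: "infinite {n. offset n = i}"
  unfolding infinite_nat_iff_unbounded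
proof
  fix m
  have "m + i < 2 ^ (m + i)" by (rule less_exp)
  then have "m < 2 ^ (m + i) + i" "i < 2 ^ (m + i)" by linarith+
  \<comment> \<open>The exponent is large enough both to exceed m and to leave room for the offset i.\<close>
  then have "m < 2 ^ (m + i) + i" "offset (2 ^ (m + i) + i) = i" by (auto intro: offset_eq)
  then show "\<exists>n>m. n \<in> {n. offset n = i}" by blast
qed

lemma infinite_offset_neq_0: "infinite {n. offset n \<noteq> 0}"
  using infinite_offset_eq[of 1] by (rule contrapos_nn) (auto elim: rev_finite_subset)

text \<open>
  Type \<open>\<omega>\<^sup>* + \<omega>\<close>: the numbers of offset 0 in descending order, then all others in ascending order.
\<close>

definition zeta_le :: "nat \<Rightarrow> nat \<Rightarrow> bool" where
  "zeta_le m n \<longleftrightarrow> (if offset m = 0 then offset n = 0 \<longrightarrow> n \<le> m else offset n \<noteq> 0 \<and> m \<le> n)"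

text \<open>
  The offsets index the summands, which come in descending order and are each of type \<open>\<omega>\<close>.
\<close>

definition omega_omega_star_le :: "nat \<Rightarrow> nat \<Rightarrow> bool" where
  "omega_omega_star_le m n \<longleftrightarrow> offset n < offset m \<or> (offset m = offset n \<and> m \<le> n)"

text \<open>
  Comparison of the dyadic fractions \<open>eta_val\<close> below, with denominators cleared.
\<close>

definition eta_le :: "nat \<Rightarrow> nat \<Rightarrow> bool" where
  "eta_le m n \<longleftrightarrow> (2 * m + 3) * 2 ^ lg (Suc n) \<le> (2 * n + 3) * 2 ^ lg (Suc m)"

text \<open>
  With \<open>k = lg (n + 1)\<close> this is \<open>(2 (n + 1) + 1) / 2\<^sup>k\<close>, so the numbers \<open>n\<close> enumerate the dyadic
  fractions strictly between 2 and 4: as \<open>n + 1\<close> runs through the interval from \<open>2\<^sup>k\<close> to \<open>2\<^sup>k\<^sup>+\<^sup>1\<close>, the odd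
  multiples of \<open>1 / 2\<^sup>k\<close>. Equivalently, \<open>n + 1\<close> is a node of the binary tree in which \<open>m\<close> has the
  children \<open>2m\<close> and \<open>2m + 1\<close>, and the order is the in-order traversal.
\<close>

definition eta_val :: "nat \<Rightarrow> real" where
  "eta_val n = real (2 * n + 3) / 2 ^ lg (Suc n)"

lemma eta_le_iff: "eta_le m n \<longleftrightarrow> eta_val m \<le> eta_val n"
proof -
  have "eta_val m \<le> eta_val n \<longleftrightarrow>
    real (2 * m + 3) * 2 ^ lg (Suc n) \<le> real (2 * n + 3) * 2 ^ lg (Suc m)"
    by (simp add: eta_val_def divide_simps mult.commute)
  also have "\<dots> \<longleftrightarrow> real ((2 * m + 3) * 2 ^ lg (Suc n)) \<le> real ((2 * n + 3) * 2 ^ lg (Suc m))"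
    by simp
  finally show ?thesis unfolding eta_le_def of_nat_le_iff ..
qed

text \<open>
  The numerators are odd, so the fractions are in lowest terms.
\<close>

lemma inj_eta_val: "inj eta_val"
proof
  fix m n assume "eta_val m = eta_val n"
  then have "eta_le m n" "eta_le n m" by (simp_all add: eta_le_iff)
  then have eq: "(2 * m + 3) * 2 ^ lg (Suc n) = (2 * n + 3) * 2 ^ lg (Suc m)"
    by (simp add: eta_le_def)
  have "\<not> lg (Suc i) < lg (Suc j)"
    if eq: "(2 * i + 3) * 2 ^ lg (Suc j) = (2 * j + 3) * 2 ^ lg (Suc i)" for i j
  proof
    assume "lg (Suc i) < lg (Suc j)"
    then obtain d where "lg (Suc j) = lg (Suc i) + Suc d" using less_imp_Suc_add by fastforce
    with eq have "(2 * i + 3) * 2 ^ Suc d = 2 * j + 3" by (simp add: power_add)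
    then have "even (2 * j + 3)" by (metis dvd_triv_right even_mult_iff power_Suc dvd_triv_left)
    then show False by simp
  qed
  from this[OF eq] this[OF eq[symmetric]] have "lg (Suc m) = lg (Suc n)" by simp
  with eq show "m = n" by simp
qed

text \<open>
  The node reached from \<open>n + 1\<close> by one step to the right and \<open>j\<close> steps to the left; these nodes
  approach \<open>n\<close> from the right.
\<close>

lemma eta_val_child:
  "eta_val ((n + 1) * 2 ^ Suc j + 2 ^ j - 1) = eta_val n + 1 / 2 ^ (Suc j + lg (Suc n))"
proof -
  let ?m = "(n + 1) * 2 ^ Suc j + 2 ^ j - 1" and ?k = "lg (Suc n)"
  have pos: "(2::nat) ^ j > 0" by simp
  then have S: "Suc ?m = (n + 1) * 2 ^ Suc j + 2 ^ j" by simp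
  have "lg (Suc ?m) = Suc j + ?k"
  proof (rule lg_eq)
    have "2 ^ ?k \<le> n + 1" using power_lg_le[of "Suc n"] by simp
    then have "2 ^ Suc j * 2 ^ ?k \<le> 2 ^ Suc j * (n + 1)" by (rule mult_le_mono2)
    then show "2 ^ (Suc j + ?k) \<le> Suc ?m" unfolding S power_add by (simp add: mult.commute)
    have "n + 2 \<le> 2 ^ Suc ?k" using less_power_Suc_lg[of "Suc n"] by simp
    then have "2 ^ Suc j * (n + 2) \<le> 2 ^ Suc j * 2 ^ Suc ?k" by (rule mult_le_mono2)
    moreover have "Suc ?m < 2 ^ Suc j * (n + 2)" unfolding S using pos by (simp add: algebra_simps)
    moreover have "(2::nat) ^ Suc (Suc j + ?k) = 2 ^ Suc j * 2 ^ Suc ?k" by (simp add: power_add)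
    ultimately show "Suc ?m < 2 ^ Suc (Suc j + ?k)" by (simp only: less_le_trans)
  qed
  moreover have "real (2 * ?m + 3) = real (2 * n + 3) * 2 ^ Suc j + 1"
  proof -
    have "2 * x + 3 = 2 * Suc x + 1" for x by simp
    then have "2 * ?m + 3 = 2 * Suc ?m + 1" .
    also have "\<dots> = (2 * n + 3) * 2 ^ Suc j + 1" unfolding S by (simp add: algebra_simps)
    finally show ?thesis by (simp only: of_nat_add of_nat_mult of_nat_power of_nat_numeral of_nat_1)
  qed
  ultimately have "eta_val ?m = (real (2 * n + 3) * 2 ^ Suc j + 1) / 2 ^ (Suc j + ?k)"
    unfolding eta_val_def by (simp only:)
  also have "\<dots> = eta_val n + 1 / 2 ^ (Suc j + ?k)"
    unfolding eta_val_def power_add by (simp add: add_divide_distrib)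
  finally show ?thesis .
qed

lemma eta_val_dense: "eta_val m < eta_val n \<Longrightarrow> \<exists>k. eta_val m < eta_val k \<and> eta_val k < eta_val n"
proof -
  assume "eta_val m < eta_val n"
  then have "eta_val n - eta_val m > 0" by simp
  then obtain j where j: "(1 / 2) ^ j < eta_val n - eta_val m"
    using real_arch_pow_inv[of "eta_val n - eta_val m" "1/2"] by auto
  have "(1 / 2 :: real) ^ (j + Suc (lg (Suc m))) \<le> (1 / 2) ^ j" by (rule power_decreasing) auto
  then have "(1::real) / 2 ^ (Suc j + lg (Suc m)) \<le> (1 / 2) ^ j" by (simp add: power_one_over)
  with j show ?thesis
    by (intro exI[of _ "(m + 1) * 2 ^ Suc j + 2 ^ j - 1"]) (simp only: eta_val_child, simp)
qed

lemma eta_val_unbounded_above: "\<exists>k. eta_val n < eta_val k"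
  using eta_val_child[of n 0] by (intro exI[of _ "(n + 1) * 2 ^ Suc 0 + 2 ^ 0 - 1"]) simp

lemma eta_val_unbounded_below: "\<exists>k. eta_val k < eta_val n"
proof
  have "lg (Suc (2 * n + 1)) = Suc (lg (Suc n))"
    using power_lg_le[of "Suc n"] less_power_Suc_lg[of "Suc n"] by (intro lg_eq) auto
  then show "eta_val (2 * n + 1) < eta_val n"
    by (simp add: eta_val_def field_simps)
qed

text \<open>
  The forth half of Cantor's argument: the values are chosen one after the other, each strictly
  between the images of its finitely many predecessors on the left and on the right. The target carries
  an arbitrary transitive relation, so that farness can take the place of the order.
\<close>

lemma embed_countable_in_dense:
  fixes v :: "nat \<Rightarrow> real" and lt :: "'b \<Rightarrow> 'b \<Rightarrow> bool"
  assumes "inj v" and trans: "\<And>x y z. lt x y \<Longrightarrow> lt y z \<Longrightarrow> lt x z" and "T \<noteq> {}"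
    and below: "\<And>x. x \<in> T \<Longrightarrow> \<exists>w\<in>T. lt w x" and above: "\<And>x. x \<in> T \<Longrightarrow> \<exists>w\<in>T. lt x w"
    and between: "\<And>x y. x \<in> T \<Longrightarrow> y \<in> T \<Longrightarrow> lt x y \<Longrightarrow> \<exists>w\<in>T. lt x w \<and> lt w y"
  shows "\<exists>e. \<forall>m n. v m < v n \<longrightarrow> lt (e m) (e n)"
proof -
  \<comment> \<open>\<open>P e n z\<close>: the value \<open>z\<close> is admissible at \<open>n\<close>, given the values of \<open>e\<close> below \<open>n\<close>.\<close>
  define P where "P e n z \<longleftrightarrow> z \<in> T \<and>
    (\<forall>m<n. (v m < v n \<longrightarrow> lt (e m) z) \<and> (v n < v m \<longrightarrow> lt z (e m)))" for e n z
  have "\<exists>e. \<forall>n. P e n (e n)"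
  proof (rule dependent_wellorder_choice)
    fix n e assume IH: "\<And>m. m < n \<Longrightarrow> P e m (e m)"
    have mono: "lt (e m) (e m')" if "m < n" "m' < n" "v m < v m'" for m m'
      using IH[of m] IH[of m'] that unfolding P_def by (metis less_asym nat_neq_iff)
    have inT: "e m \<in> T" if "m < n" for m using IH[OF that] by (simp add: P_def)
    define A where "A = {m. m < n \<and> v m < v n}"
    define B where "B = {m. m < n \<and> v n < v m}"
    have A: "\<exists>a\<in>A. \<forall>m\<in>A. v m \<le> v a" if "A \<noteq> {}"
    proof -
      have "finite A" by (simp add: A_def)
      with that have "Max (v ` A) \<in> v ` A" by (intro Max_in) auto
      then obtain a where "a \<in> A" "Max (v ` A) = v a" by auto
      moreover have "\<forall>m\<in>A. v m \<le> Max (v ` A)" using \<open>finite A\<close> by auto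
      ultimately show ?thesis by auto
    qed
    have B: "\<exists>b\<in>B. \<forall>m\<in>B. v b \<le> v m" if "B \<noteq> {}"
    proof -
      have "finite B" by (simp add: B_def)
      with that have "Min (v ` B) \<in> v ` B" by (intro Min_in) auto
      then obtain b where "b \<in> B" "Min (v ` B) = v b" by auto
      moreover have "\<forall>m\<in>B. Min (v ` B) \<le> v m" using \<open>finite B\<close> by auto
      ultimately show ?thesis by auto
    qed
    have "\<exists>z\<in>T. (\<forall>m\<in>A. lt (e m) z) \<and> (\<forall>m\<in>B. lt z (e m))"
    proof -
      have upA: "\<forall>m\<in>A. lt (e m) z" if "a \<in> A" "\<forall>m\<in>A. v m \<le> v a" "lt (e a) z" for a z
      proof
        fix m assume "m \<in> A"
        with that(2) consider "v m < v a" | "v m = v a" by fastforce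
        then show "lt (e m) z"
        proof cases
          case 1
          then have "lt (e m) (e a)" using mono \<open>m \<in> A\<close> that(1) by (simp add: A_def)
          with that(3) show ?thesis by (rule trans[rotated])
        next
          case 2
          with assms(1) that(3) show ?thesis by (simp add: inj_eq)
        qed
      qed
      have dnB: "\<forall>m\<in>B. lt z (e m)" if "b \<in> B" "\<forall>m\<in>B. v b \<le> v m" "lt z (e b)" for b z
      proof
        fix m assume "m \<in> B"
        with that(2) consider "v b < v m" | "v m = v b" by fastforce
        then show "lt z (e m)"
        proof cases
          case 1
          then have "lt (e b) (e m)" using mono \<open>m \<in> B\<close> that(1) by (simp add: B_def)
          with that(3) show ?thesis by (rule trans)
        next
          case 2
          with assms(1) that(3) show ?thesis by (simp add: inj_eq)
        qed
      qed
      show ?thesis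
      proof (cases "A = {}")
        case True
        show ?thesis
        proof (cases "B = {}")
          case True
          with \<open>A = {}\<close> \<open>T \<noteq> {}\<close> show ?thesis by auto
        next
          case False
          with B obtain b where b: "b \<in> B" "\<forall>m\<in>B. v b \<le> v m" by blast
          then obtain z where "z \<in> T" "lt z (e b)" using below[OF inT[of b]] by (auto simp: B_def)
          with dnB[OF b] \<open>A = {}\<close> show ?thesis by blast
        qed
      next
        case False
        with A obtain a where a: "a \<in> A" "\<forall>m\<in>A. v m \<le> v a" by blast
        show ?thesis
        proof (cases "B = {}")
          case True
          obtain z where "z \<in> T" "lt (e a) z" using above[OF inT[of a]] a by (auto simp: A_def)
          with upA[OF a] True show ?thesis by blast
        next
          case False
          with B obtain b where b: "b \<in> B" "\<forall>m\<in>B. v b \<le> v m" by blast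
          with a have "lt (e a) (e b)" by (intro mono) (auto simp: A_def B_def)
          then obtain z where "z \<in> T" "lt (e a) z" "lt z (e b)"
            using between[OF inT[of a] inT[of b]] a b by (auto simp: A_def B_def)
          with upA[OF a] dnB[OF b] show ?thesis by blast
        qed
      qed
    qed
    then show "\<exists>z. P e n z" unfolding P_def A_def B_def by blast
  qed (auto simp: P_def)
  then obtain e where e: "P e n (e n)" for n by blast
  have "lt (e m) (e n)" if "v m < v n" for m n
    using e[of m] e[of n] that unfolding P_def by (metis less_irrefl less_asym nat_neq_iff)
  then show ?thesis by blast
qed

lemma recursive_lg: assumes "recursive n f" shows "recursive n (\<lambda>xs. lg (f xs))"
proof -
  have "recursive 1 (\<lambda>xs. LEAST k. (k # xs) ! 1 < 2 ^ Suc ((k # xs) ! 0))"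
  proof (rule recursive_Least)
    show "decidable (Suc 1) (\<lambda>xs. xs ! 1 < 2 ^ Suc (xs ! 0))"
      by (intro decidable_less recursive_power2 recursive_Suc recursive_nth) auto
    show "\<exists>k. (k # xs) ! 1 < 2 ^ Suc ((k # xs) ! 0)" for xs
      using less_power_Suc_lg[of "xs ! 0"] by (intro exI[of _ "lg (xs ! 0)"]) simp
  qed
  then have "recursive 1 (\<lambda>xs. lg (xs ! 0))" by (simp add: lg_def)
  from recursive_subst1[OF this assms] show ?thesis .
qed

lemma recursive_offset: "recursive n f \<Longrightarrow> recursive n (\<lambda>xs. offset (f xs))"
  unfolding offset_def by (intro recursive_diff recursive_power2 recursive_lg)

lemma decidable_offset_eq_0: "recursive n f \<Longrightarrow> decidable n (\<lambda>xs. offset (f xs) = 0)"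
  by (intro decidable_eq recursive_offset recursive_const)

lemma decidable_zeta_le: "decidable 2 (\<lambda>xs. zeta_le (xs ! 0) (xs ! 1))"
proof -
  have eq: "zeta_le m n \<longleftrightarrow> offset m = 0 \<and> (\<not> offset n = 0 \<or> n \<le> m) \<or>
    \<not> offset m = 0 \<and> (\<not> offset n = 0 \<and> m \<le> n)" for m n
    by (auto simp: zeta_le_def)
  show ?thesis unfolding eq
    by (intro decidable_disj decidable_conj decidable_not decidable_le decidable_offset_eq_0
        recursive_nth) auto
qed

lemma decidable_omega_omega_star_le: "decidable 2 (\<lambda>xs. omega_omega_star_le (xs ! 0) (xs ! 1))"
  unfolding omega_omega_star_le_def
  by (intro decidable_disj decidable_conj decidable_less decidable_eq decidable_le recursive_offset
      recursive_nth) auto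

lemma decidable_eta_le: "decidable 2 (\<lambda>xs. eta_le (xs ! 0) (xs ! 1))"
  unfolding eta_le_def
  by (intro decidable_le recursive_mult recursive_add recursive_power2 recursive_lg recursive_Suc
      recursive_const recursive_nth) auto

lemma decidable_nat_le: "decidable 2 (\<lambda>xs. xs ! 0 \<le> xs ! 1)"
  by (intro decidable_le recursive_nth) auto

lemma no_greatest:
  assumes "R \<in> {(\<le>), zeta_le, omega_omega_star_le, eta_le}" shows "\<exists>n. \<not> R n m"
proof -
  have larger: "\<exists>n>m. offset n = i" for m i
    using infinite_offset_eq[of i] unfolding infinite_nat_iff_unbounded by blast
  from assms consider "R = (\<le>)" | "R = zeta_le" | "R = omega_omega_star_le" | "R = eta_le" by blast
  then show ?thesis
  proof cases
    case 1
    then show ?thesis by (intro exI[of _ "Suc m"]) simp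
  next
    case 2
    obtain n where "m < n" "offset n = 1" using larger by blast
    with 2 show ?thesis by (intro exI[of _ n]) (simp add: zeta_le_def)
  next
    case 3
    obtain n where "m < n" "offset n = offset m" using larger by blast
    with 3 show ?thesis by (intro exI[of _ n]) (simp add: omega_omega_star_le_def)
  next
    case 4
    obtain n where "eta_val m < eta_val n" using eta_val_unbounded_above by blast
    with 4 show ?thesis by (intro exI[of _ n]) (simp add: eta_le_iff)
  qed
qed

section \<open>A decidable limit-dense suborder\<close>

context linorder
begin

text \<open>
  An infinite order with finite initial segments has type \<open>\<omega>\<close>: the rank of \<open>s\<close> maps the points below \<open>s\<close>
  injectively into as many numbers, hence onto them, so no rank is skipped.
\<close>

lemma bij_betw_rank:
  assumes "infinite S" "\<And>s. s \<in> S \<Longrightarrow> finite {x\<in>S. x < s}"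
  shows "bij_betw (\<lambda>s. card {x\<in>S. x < s}) S UNIV"
    and "\<And>s t. s \<in> S \<Longrightarrow> t \<in> S \<Longrightarrow> card {x\<in>S. x < s} \<le> card {x\<in>S. x < t} \<longleftrightarrow> s \<le> t"
proof -
  let ?r = "\<lambda>s. card {x\<in>S. x < s}"
  have mono: "?r s < ?r t" if "s \<in> S" "t \<in> S" "s < t" for s t
    using assms(2)[OF that(2)] that by (intro psubset_card_mono) auto
  show le: "?r s \<le> ?r t \<longleftrightarrow> s \<le> t" if "s \<in> S" "t \<in> S" for s t
    using mono[of s t] mono[of t s] that less_linear[of s t] by (auto simp: not_le[symmetric])
  have inj: "inj_on ?r S"
  proof (rule inj_onI)
    fix s t assume "s \<in> S" "t \<in> S" "?r s = ?r t"
    with le[of s t] le[of t s] show "s = t" by auto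
  qed
  have "n \<in> ?r ` S" for n
  proof -
    have "infinite (?r ` S)" using inj assms(1) by (simp add: finite_image_iff)
    then obtain s where s: "s \<in> S" "n < ?r s"
      by (metis (no_types, lifting) bounded_nat_set_is_finite finite_nat_set_iff_bounded_le
          imageE linorder_not_less)
    let ?P = "{x\<in>S. x < s}"
    have "?r ` ?P \<subseteq> {..<?r s}" using mono s(1) by auto
    moreover have "card (?r ` ?P) = ?r s"
      by (rule card_image) (rule inj_on_subset[OF inj], auto)
    ultimately have "?r ` ?P = {..<?r s}" by (intro card_subset_eq) auto
    with s(2) have "n \<in> ?r ` ?P" by blast
    then show ?thesis by blast
  qed
  with inj show "bij_betw ?r S UNIV" unfolding bij_betw_def by blast
qed

end

lemma bij_betw_nat_rank:
  fixes N :: "nat set" assumes "infinite N"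
  shows "bij_betw (\<lambda>s. card {x\<in>N. x < s}) N UNIV"
    and "\<And>s t. s \<in> N \<Longrightarrow> t \<in> N \<Longrightarrow> card {x\<in>N. x < s} \<le> card {x\<in>N. x < t} \<longleftrightarrow> s \<le> t"
  using bij_betw_rank[OF assms] by auto

context linorder
begin

lemma omega_type_iso:
  assumes "infinite S" "\<And>s. s \<in> S \<Longrightarrow> finite {x\<in>S. x < s}" "infinite (N :: nat set)"
  shows "\<exists>f. bij_betw f N S \<and> (\<forall>m\<in>N. \<forall>n\<in>N. f m \<le> f n \<longleftrightarrow> m \<le> n)"
proof -
  define r where "r = (\<lambda>s. card {x\<in>S. x < s})"
  define q where "q = (\<lambda>n. card {x\<in>N. x < n})"
  have r: "bij_betw r S UNIV" and r_le: "\<And>s t. s \<in> S \<Longrightarrow> t \<in> S \<Longrightarrow> r s \<le> r t \<longleftrightarrow> s \<le> t"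
    using bij_betw_rank[OF assms(1,2)] unfolding r_def by blast+
  have q: "bij_betw q N UNIV" and q_le: "\<And>m n. m \<in> N \<Longrightarrow> n \<in> N \<Longrightarrow> q m \<le> q n \<longleftrightarrow> m \<le> n"
    using bij_betw_nat_rank[OF assms(3)] unfolding q_def by blast+
  define f where "f = (\<lambda>n. inv_into S r (q n))"
  have f: "f n \<in> S" "r (f n) = q n" for n
    using r unfolding f_def bij_betw_def by (auto intro: inv_into_into f_inv_into_f)
  have "bij_betw (inv_into S r \<circ> q) N S"
    using q bij_betw_inv_into[OF r] by (rule bij_betw_trans)
  moreover have "inv_into S r \<circ> q = f" by (auto simp: f_def)
  moreover have "f m \<le> f n \<longleftrightarrow> m \<le> n" if "m \<in> N" "n \<in> N" for m n
    using r_le[OF f(1)[of m] f(1)[of n]] q_le[OF that] f(2) by simp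
  ultimately show ?thesis by (intro exI[of _ f]) simp
qed

text \<open>
  This holds only for \<open>x < y\<close>.
\<close>

definition far :: "'a \<Rightarrow> 'a \<Rightarrow> bool" where
  "far x y \<longleftrightarrow> infinite {z. x < z \<and> z < y}"

text \<open>
  The part at and above \<open>u\<close> of the set of points at finite distance from \<open>u\<close>. If it is infinite, it has
  type \<open>\<omega>\<close>.
\<close>

definition block_up :: "'a \<Rightarrow> 'a set" where
  "block_up u = {w. u \<le> w \<and> \<not> far u w}"

definition block_down :: "'a \<Rightarrow> 'a set" where
  "block_down u = {w. w \<le> u \<and> \<not> far w u}"

definition limit_dense_embedding :: "(nat \<Rightarrow> nat \<Rightarrow> bool) \<Rightarrow> (nat \<Rightarrow> 'a) \<Rightarrow> bool" where
  "limit_dense_embedding R e \<longleftrightarrow>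
     inj e \<and> limit_dense (range e) \<and> (\<forall>m n. R m n \<longleftrightarrow> e m \<le> e n)"

lemma far_imp_less: "far x y \<Longrightarrow> x < y"
  unfolding far_def using less_trans by (metis (mono_tags, lifting) empty_Collect_eq finite.emptyI)

lemma far_mono: "far u v \<Longrightarrow> x \<le> u \<Longrightarrow> v \<le> y \<Longrightarrow> far x y"
  unfolding far_def by (erule infinite_super[rotated]) (auto intro: le_less_trans less_le_trans)

lemma far_trans: "far x y \<Longrightarrow> far y z \<Longrightarrow> far x z"
  by (rule far_mono[of x y]) (auto dest: far_imp_less)

lemma not_far_trans:
  assumes "\<not> far x y" "\<not> far y z" shows "\<not> far x z"
proof -
  have "{w. x < w \<and> w < z} \<subseteq> {w. x < w \<and> w < y} \<union> {y} \<union> {w. y < w \<and> w < z}"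
    by auto
  from finite_subset[OF this] assms show ?thesis unfolding far_def by auto
qed

lemma block_up_self: "u \<in> block_up u"
  using far_imp_less by (auto simp: block_up_def)

text \<open>
  A block lies on one side of every point outside it.
\<close>

lemma block_up_less_far: "w \<in> block_up u \<Longrightarrow> far u y \<Longrightarrow> w < y"
  unfolding block_up_def using far_mono[of u y u w] by (auto simp: not_le[symmetric])

lemma block_up_no_max:
  assumes "infinite (block_up u)" "w \<in> block_up u" shows "\<exists>w'\<in>block_up u. w < w'"
proof (rule ccontr)
  assume "\<not> ?thesis"
  then have "z \<le> w" if "z \<in> block_up u" for z using that by (auto simp: not_less[symmetric])
  then have "block_up u \<subseteq> {u, w} \<union> {z. u < z \<and> z < w}"
    by (auto simp: block_up_def less_le)
  moreover have "finite {z. u < z \<and> z < w}" using assms(2) by (simp add: block_up_def far_def)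
  ultimately show False using assms(1) by (auto dest: finite_subset)
qed

lemma block_up_initial_segment_finite:
  assumes "s \<in> block_up u" shows "finite {x\<in>block_up u. x < s}"
proof (rule finite_subset)
  show "{x\<in>block_up u. x < s} \<subseteq> insert u {z. u < z \<and> z < s}"
    by (auto simp: block_up_def less_le)
  show "finite (insert u {z. u < z \<and> z < s})" using assms by (simp add: block_up_def far_def)
qed

lemma block_up_iso:
  "infinite (block_up u) \<Longrightarrow> infinite (N :: nat set) \<Longrightarrow>
   \<exists>f. bij_betw f N (block_up u) \<and> (\<forall>m\<in>N. \<forall>n\<in>N. f m \<le> f n \<longleftrightarrow> m \<le> n)"
  by (rule omega_type_iso) (auto intro: block_up_initial_segment_finite)

lemma dual_far: "linorder.far (\<lambda>x y. y < x) x y \<longleftrightarrow> far y x"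
  unfolding far_def linorder.far_def[OF dual_linorder] by (simp add: conj_commute)

lemma dual_block_up: "linorder.block_up (\<lambda>x y. y \<le> x) (\<lambda>x y. y < x) u = block_down u"
  unfolding block_down_def linorder.block_up_def[OF dual_linorder] dual_far ..

lemma dual_block_down: "linorder.block_down (\<lambda>x y. y \<le> x) (\<lambda>x y. y < x) u = block_up u"
  unfolding block_up_def linorder.block_down_def[OF dual_linorder] dual_far ..

lemma dual_limit_dense: "linorder.limit_dense (\<lambda>x y. y < x) D \<longleftrightarrow> limit_dense D"
  unfolding limit_dense_def linorder.limit_dense_def[OF dual_linorder]
  by (simp add: disj_commute conj_commute)

lemma dual_limit_dense_embedding:
  "linorder.limit_dense_embedding (\<lambda>x y. y \<le> x) (\<lambda>x y. y < x) R e \<longleftrightarrow>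
   limit_dense_embedding (\<lambda>m n. R n m) e"
  unfolding limit_dense_embedding_def linorder.limit_dense_embedding_def[OF dual_linorder]
    dual_limit_dense by blast

lemmas block_down_no_min = linorder.block_up_no_max[OF dual_linorder, unfolded dual_block_up]
lemmas block_down_greater_far =
  linorder.block_up_less_far[OF dual_linorder, unfolded dual_block_up dual_far]
lemmas block_down_self = linorder.block_up_self[OF dual_linorder, unfolded dual_block_up]
lemmas block_down_final_segment_finite =
  linorder.block_up_initial_segment_finite[OF dual_linorder, unfolded dual_block_up]
lemmas reverse_omega_type_iso = linorder.omega_type_iso[OF dual_linorder]

text \<open>
  The points with finitely many predecessors form an initial segment of type \<open>\<omega>\<close>; every point outside
  it lies above all of it and so is a limit from below.
\<close>

lemma embedding_omega:
  assumes "infinite {z. finite {x. x < z}}"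
  shows "\<exists>e. limit_dense_embedding (\<le>) e"
proof -
  let ?S = "{z. finite {x. x < z}}"
  have fin: "finite {x\<in>?S. x < s}" if "s \<in> ?S" for s
    using that by (auto elim: rev_finite_subset)
  obtain e where e: "bij_betw e (UNIV :: nat set) ?S" "\<forall>m n. e m \<le> e n \<longleftrightarrow> m \<le> n"
    using omega_type_iso[OF assms fin infinite_UNIV_nat] by auto
  have "limit_dense ?S" unfolding limit_dense_def
  proof (intro allI impI disjI1 conjI)
    fix y assume y: "y \<notin> ?S"
    have less: "s < y" if "s \<in> ?S" for s
    proof (rule ccontr)
      assume "\<not> s < y"
      then have "{x. x < y} \<subseteq> {x. x < s}" by (auto simp: not_less intro: less_le_trans)
      with y that show False by (auto dest: finite_subset)
    qed
    from assms obtain s where "s \<in> ?S" by (metis finite.emptyI ex_in_conv)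
    with less show "\<exists>d\<in>?S. d < y" by blast
    show "\<forall>a\<in>?S. a < y \<longrightarrow> (\<exists>d\<in>?S. a < d \<and> d < y)"
    proof (intro ballI impI)
      fix a assume a: "a \<in> ?S"
      have "\<exists>d\<in>?S. a < d"
      proof (rule ccontr)
        assume "\<not> (\<exists>d\<in>?S. a < d)"
        then have "z \<le> a" if "z \<in> ?S" for z using that by (auto simp: not_less[symmetric])
        then have "?S \<subseteq> insert a {x. x < a}" by (auto simp: less_le)
        with a assms show False by (auto dest: finite_subset)
      qed
      with less show "\<exists>d\<in>?S. a < d \<and> d < y" by blast
    qed
  qed
  with e show ?thesis unfolding limit_dense_embedding_def bij_betw_def by metis
qed

text \<open>
  The block of \<open>u\<close> has type \<open>\<zeta>\<close>, and every other point lies above all of it or below all of it.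
\<close>

lemma embedding_zeta:
  assumes up: "infinite (block_up u)" and down: "infinite (block_down u)"
  shows "\<exists>e. limit_dense_embedding zeta_le e"
proof -
  let ?N = "{n. offset n \<noteq> 0}" and ?N' = "{n. offset n = 0}" and ?S' = "block_down u - {u}"
  obtain f where f: "bij_betw f ?N (block_up u)" "\<forall>m\<in>?N. \<forall>n\<in>?N. f m \<le> f n \<longleftrightarrow> m \<le> n"
    using block_up_iso[OF up infinite_offset_neq_0] by blast
  have "infinite ?S'" using down by simp
  moreover have "finite {x\<in>?S'. s < x}" if "s \<in> ?S'" for s
    using that block_down_final_segment_finite[of s u] by (auto elim: rev_finite_subset)
  ultimately obtain f' where f': "bij_betw f' ?N' ?S'"
    "\<forall>m\<in>?N'. \<forall>n\<in>?N'. f' n \<le> f' m \<longleftrightarrow> m \<le> n"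
    using reverse_omega_type_iso[of ?S' ?N'] infinite_offset_eq[of 0] by blast
  define e where "e n = (if offset n = 0 then f' n else f n)" for n
  have f_in: "u \<le> f n" if "offset n \<noteq> 0" for n
    using bij_betwE[OF f(1)] that by (auto simp: block_up_def)
  have f'_in: "f' n < u" if "offset n = 0" for n
    using bij_betwE[OF f'(1)] that by (auto simp: block_down_def less_le)
  have le: "zeta_le m n \<longleftrightarrow> e m \<le> e n" for m n
    using f(2) f'(2) f_in[of m] f_in[of n] f'_in[of m] f'_in[of n]
    by (auto simp: zeta_le_def e_def intro: less_imp_le less_le_trans dest: le_less_trans)
  have "range e = e ` ?N \<union> e ` ?N'" by auto
  also have "\<dots> = f ` ?N \<union> f' ` ?N'" by (simp add: e_def)
  also have "\<dots> = block_up u \<union> block_down u"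
    using f(1) f'(1) block_up_self[of u] by (auto simp: bij_betw_def)
  finally have range: "range e = block_up u \<union> block_down u" .
  have "inj e"
  proof (rule injI)
    fix m n assume "e m = e n"
    then have "zeta_le m n" "zeta_le n m" using le by auto
    then show "m = n" by (auto simp: zeta_le_def split: if_splits)
  qed
  moreover have "limit_dense (range e)" unfolding limit_dense_def range
  proof (intro allI impI)
    fix y assume y: "y \<notin> block_up u \<union> block_down u"
    let ?D = "block_up u \<union> block_down u"
    have u: "u \<in> ?D" using block_up_self by blast
    show "((\<exists>d\<in>?D. d < y) \<and> (\<forall>a\<in>?D. a < y \<longrightarrow> (\<exists>d\<in>?D. a < d \<and> d < y))) \<or>
      ((\<exists>d\<in>?D. y < d) \<and> (\<forall>a\<in>?D. y < a \<longrightarrow> (\<exists>d\<in>?D. y < d \<and> d < a)))"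
    proof (cases "u < y")
      case True
      with y have far: "far u y" by (auto simp: block_up_def)
      have "\<exists>d\<in>?D. a < d \<and> d < y" if "a \<in> ?D" "a < y" for a
      proof (cases "u \<le> a")
        case True
        then have "a \<in> block_up u"
          using that(1) block_up_self[of u] by (auto simp: block_down_def le_less dest: less_asym)
        then obtain d where "d \<in> block_up u" "a < d" using block_up_no_max[OF up] by blast
        with block_up_less_far[OF _ far] show ?thesis by blast
      next
        case False
        with u \<open>u < y\<close> show ?thesis by (auto simp only: not_le)
      qed
      then have "\<forall>a\<in>?D. a < y \<longrightarrow> (\<exists>d\<in>?D. a < d \<and> d < y)" by (intro ballI impI)
      moreover have "\<exists>d\<in>?D. d < y" using u True by (rule bexI[rotated])
      ultimately show ?thesis by (intro disjI1 conjI)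
    next
      case False
      with y u have "y < u" by (auto simp: not_less le_less)
      with y have far: "far y u" by (auto simp: block_down_def)
      have "\<exists>d\<in>?D. y < d \<and> d < a" if "a \<in> ?D" "y < a" for a
      proof (cases "a \<le> u")
        case True
        then have "a \<in> block_down u"
          using that(1) block_down_self[of u] by (auto simp: block_up_def le_less dest: less_asym)
        then obtain d where "d \<in> block_down u" "d < a" using block_down_no_min[OF down] by blast
        with block_down_greater_far[OF _ far] show ?thesis by blast
      next
        case False
        with u \<open>y < u\<close> show ?thesis by (auto simp only: not_le)
      qed
      then have "\<forall>a\<in>?D. y < a \<longrightarrow> (\<exists>d\<in>?D. y < d \<and> d < a)" by (intro ballI impI)
      moreover have "\<exists>d\<in>?D. y < d" using u \<open>y < u\<close> by (rule bexI[rotated])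
      ultimately show ?thesis by (intro disjI2 conjI)
    qed
  qed
  ultimately show ?thesis using le unfolding limit_dense_embedding_def by blast
qed

text \<open>
  The union of the upper blocks of the points \<open>u i\<close>. A point outside it is a limit from below if it is
  above some \<open>u i\<close>, because it is then far above the \<open>u i\<close> of every block that has points below it;
  otherwise it is below the whole union, which has no least element.
\<close>

lemma embedding_omega_omega_star:
  fixes u :: "nat \<Rightarrow> 'a"
  assumes u: "\<And>i. far (u (Suc i)) (u i)" and up: "\<And>i. infinite (block_up (u i))"
  shows "\<exists>e. limit_dense_embedding omega_omega_star_le e"
proof -
  have far: "far (u j) (u i)" if "i < j" for i j
    using that
  proof (induction j)
    case (Suc j)
    with u[of j] show ?case by (cases "i = j") (auto intro: far_trans)
  qed simp
  have "\<forall>i. \<exists>f. bij_betw f {n. offset n = i} (block_up (u i)) \<and>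
    (\<forall>m\<in>{n. offset n = i}. \<forall>n\<in>{n. offset n = i}. f m \<le> f n \<longleftrightarrow> m \<le> n)"
    using block_up_iso[OF up infinite_offset_eq] by blast
  then obtain f where f: "\<And>i. bij_betw (f i) {n. offset n = i} (block_up (u i))"
    "\<And>i m n. offset m = i \<Longrightarrow> offset n = i \<Longrightarrow> f i m \<le> f i n \<longleftrightarrow> m \<le> n"
    by (auto dest!: choice)
  define e where "e n = f (offset n) n" for n
  have e_in: "e n \<in> block_up (u (offset n))" for n
    using f(1)[of "offset n"] by (auto simp: e_def bij_betw_def)
  have less: "e m < e n" if "offset n < offset m" for m n
    using block_up_less_far[OF e_in[of m] far[OF that]] e_in[of n]
    by (auto simp: block_up_def intro: less_le_trans)
  have le: "omega_omega_star_le m n \<longleftrightarrow> e m \<le> e n" for m n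
  proof -
    consider "offset n < offset m" | "offset m = offset n" | "offset m < offset n"
      using nat_neq_iff by blast
    then show ?thesis
    proof cases
      case 1
      with less[OF 1] show ?thesis by (simp add: omega_omega_star_le_def)
    next
      case 2
      with f(2)[of m "offset n" n] show ?thesis by (simp add: omega_omega_star_le_def e_def)
    next
      case 3
      with less[OF 3] show ?thesis by (simp add: omega_omega_star_le_def not_le)
    qed
  qed
  have range: "range e = (\<Union>i. block_up (u i))"
  proof
    show "range e \<subseteq> (\<Union>i. block_up (u i))" using e_in by auto
    show "(\<Union>i. block_up (u i)) \<subseteq> range e"
    proof
      fix x assume "x \<in> (\<Union>i. block_up (u i))"
      then obtain i where "x \<in> f i ` {n. offset n = i}" using f(1) by (auto simp: bij_betw_def)
      then show "x \<in> range e" by (auto simp: e_def)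
    qed
  qed
  have "inj e"
  proof (rule injI)
    fix m n assume "e m = e n"
    then have "omega_omega_star_le m n" "omega_omega_star_le n m" using le by auto
    then show "m = n" by (auto simp: omega_omega_star_le_def)
  qed
  moreover have "limit_dense (range e)" unfolding limit_dense_def range
  proof (intro allI impI)
    let ?D = "\<Union>i. block_up (u i)"
    have u_in: "u i \<in> ?D" for i using block_up_self by blast
    fix y assume y: "y \<notin> ?D"
    show "((\<exists>d\<in>?D. d < y) \<and> (\<forall>a\<in>?D. a < y \<longrightarrow> (\<exists>d\<in>?D. a < d \<and> d < y))) \<or>
      ((\<exists>d\<in>?D. y < d) \<and> (\<forall>a\<in>?D. y < a \<longrightarrow> (\<exists>d\<in>?D. y < d \<and> d < a)))"
    proof (cases "\<exists>i. u i < y")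
      case True
      have "\<exists>d\<in>?D. a < d \<and> d < y" if a: "a \<in> ?D" "a < y" for a
      proof -
        from a(1) obtain i where i: "a \<in> block_up (u i)" by blast
        then have "u i < y" using a(2) by (auto simp: block_up_def intro: le_less_trans)
        with y have "far (u i) y" by (auto simp: block_up_def)
        moreover obtain d where "d \<in> block_up (u i)" "a < d" using block_up_no_max[OF up i] by blast
        ultimately show ?thesis using block_up_less_far by blast
      qed
      then have "\<forall>a\<in>?D. a < y \<longrightarrow> (\<exists>d\<in>?D. a < d \<and> d < y)" by (intro ballI impI)
      moreover from True obtain i where "u i < y" ..
      with u_in have "\<exists>d\<in>?D. d < y" by (rule bexI[rotated])
      ultimately show ?thesis by (intro disjI1 conjI)
    next
      case False
      have u_greater: "y < u i" for i using False u_in[of i] y by (metis less_linear)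
      have "\<exists>d\<in>?D. y < d \<and> d < a" if a: "a \<in> ?D" for a
      proof -
        from a obtain i where "a \<in> block_up (u i)" by blast
        then have "u (Suc i) < a"
          using far_imp_less[OF u[of i]] by (auto simp: block_up_def intro: less_le_trans)
        with u_greater have "y < u (Suc i) \<and> u (Suc i) < a" by blast
        then show ?thesis using u_in by (rule bexI)
      qed
      then have "\<forall>a\<in>?D. y < a \<longrightarrow> (\<exists>d\<in>?D. y < d \<and> d < a)" by (intro ballI impI)
      moreover have "\<exists>d\<in>?D. y < d" using u_greater u_in by (rule bexI)
      ultimately show ?thesis by (intro disjI2 conjI)
    qed
  qed
  ultimately show ?thesis using le unfolding limit_dense_embedding_def by blast
qed

text \<open>
  The rationals embed into the open farness interval between \<open>x\<close> and \<open>y\<close>, with farness in place of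
  the order on the target. The image is a dense order without endpoints, so in every cut of it the
  left side is nonempty without a maximum or the right side is nonempty without a minimum.
\<close>

lemma embedding_eta:
  assumes "far x y"
    and dense: "\<And>u v. x \<le> u \<Longrightarrow> far u v \<Longrightarrow> v \<le> y \<Longrightarrow> \<exists>w. far u w \<and> far w v"
  shows "\<exists>e. limit_dense_embedding eta_le e"
proof -
  let ?T = "{w. far x w \<and> far w y}"
  have "\<exists>e. \<forall>m n. eta_val m < eta_val n \<longrightarrow> far (e m) (e n)"
  proof (rule embed_countable_in_dense[OF inj_eta_val far_trans])
    show "?T \<noteq> {}" using dense[of x y] assms(1) by auto
  next
    fix w assume w: "w \<in> ?T"
    have "x < w" "w < y" using w by (auto dest: far_imp_less)
    then show "\<exists>w'\<in>?T. far w' w" "\<exists>w'\<in>?T. far w w'"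
      using dense[of x w] dense[of w y] w by (blast intro: far_trans less_imp_le)+
  next
    fix w w' assume w: "w \<in> ?T" "w' \<in> ?T" "far w w'"
    have "x < w" "w' < y" using w by (auto dest: far_imp_less)
    then show "\<exists>z\<in>?T. far w z \<and> far z w'"
      using dense[of w w'] w by (blast intro: far_trans less_imp_le)
  qed
  then obtain e where e: "far (e m) (e n)" if "eta_val m < eta_val n" for m n by blast
  have less: "e m < e n \<longleftrightarrow> eta_val m < eta_val n" for m n
  proof -
    consider "eta_val m < eta_val n" "e m < e n" | "m = n" | "eta_val n < eta_val m" "e n < e m"
      using e far_imp_less inj_eq[OF inj_eta_val] by (metis linorder_less_linear)
    then show ?thesis by cases (auto dest: less_asym)
  qed
  have inj: "inj e"
  proof (rule injI)
    fix m n assume "e m = e n"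
    with less[of m n] less[of n m] have "eta_val m = eta_val n" by simp
    then show "m = n" using inj_eta_val by (simp add: inj_eq)
  qed
  have le: "eta_le m n \<longleftrightarrow> e m \<le> e n" for m n
    using less[of n m] not_less[of "e n" "e m"] by (simp add: eta_le_iff linorder_not_less)
  have "limit_dense (range e)" unfolding limit_dense_def
  proof (intro allI impI)
    fix y assume y: "y \<notin> range e"
    show "((\<exists>d\<in>range e. d < y) \<and> (\<forall>a\<in>range e. a < y \<longrightarrow> (\<exists>d\<in>range e. a < d \<and> d < y))) \<or>
      ((\<exists>d\<in>range e. y < d) \<and> (\<forall>a\<in>range e. y < a \<longrightarrow> (\<exists>d\<in>range e. y < d \<and> d < a)))"
    proof (rule ccontr)
      assume neg: "\<not> ?thesis"
      have ne: "e m < y \<or> y < e m" for m using y less_linear[of "e m" y] by auto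
      have "(\<forall>m. \<not> e m < y) \<or> (\<exists>n. e n < y \<and> (\<forall>m. e m < y \<longrightarrow> \<not> e n < e m))"
        using neg by auto
      moreover have "(\<forall>m. \<not> y < e m) \<or> (\<exists>n. y < e n \<and> (\<forall>m. y < e m \<longrightarrow> \<not> e m < e n))"
        using neg by auto
      ultimately consider
        "\<forall>m. \<not> e m < y" "\<forall>m. \<not> y < e m" |
        n where "\<forall>m. \<not> e m < y" "\<forall>m. y < e m \<longrightarrow> \<not> e m < e n" |
        n where "\<forall>m. \<not> y < e m" "\<forall>m. e m < y \<longrightarrow> \<not> e n < e m" |
        n k where "y < e n" "\<forall>m. y < e m \<longrightarrow> \<not> e m < e n" "e k < y" "\<forall>m. e m < y \<longrightarrow> \<not> e k < e m"
        by (elim disjE exE conjE)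
      then show False
      proof cases
        case 1
        then show ?thesis using ne by blast
      next
        case 2
        then show ?thesis using eta_val_unbounded_below[of n] ne less by blast
      next
        case 3
        then show ?thesis using eta_val_unbounded_above[of n] ne less by blast
      next
        case 4
        then have "eta_val k < eta_val n" unfolding less[symmetric] by (blast intro: less_trans)
        then obtain m where "e k < e m" "e m < e n" using eta_val_dense less by blast
        then show ?thesis using 4 ne[of m] by blast
      qed
    qed
  qed
  with inj le show ?thesis unfolding limit_dense_embedding_def by blast
qed

text \<open>
  Where farness is not dense, there are far \<open>u\<close> and \<open>v\<close> such that every point between them is at finite
  distance from one of the two.
\<close>

lemma infinite_block_between:
  assumes "\<nexists>e. limit_dense_embedding eta_le e" "far x y"
  shows "\<exists>u v. x \<le> u \<and> far u v \<and> v \<le> y \<and> (infinite (block_up u) \<or> infinite (block_down v))"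
proof -
  from embedding_eta[OF assms(2)] assms(1) obtain u v where
    uv: "x \<le> u" "far u v" "v \<le> y" "\<nexists>w. far u w \<and> far w v" by blast
  have "{z. u < z \<and> z < v} \<subseteq> block_up u \<union> block_down v"
    using uv(4) by (auto simp: block_up_def block_down_def)
  with uv(2) have "infinite (block_up u) \<or> infinite (block_down v)"
    unfolding far_def by (metis finite_Un finite_subset)
  with uv show ?thesis by blast
qed

text \<open>
  A descending sequence of blocks infinite upwards is the only obstacle to a leftmost one. For a
  leftmost one, that of \<open>u\<close>, the outcome depends on the points below \<open>u\<close>: finitely many, infinitely
  many in the block of \<open>u\<close> itself, or some that are far from \<open>u\<close>.
\<close>

lemma limit_dense_embedding_if_block_up:
  assumes between: "\<And>x y. far x y \<Longrightarrow>
      \<exists>u v. x \<le> u \<and> far u v \<and> v \<le> y \<and> (infinite (block_up u) \<or> infinite (block_down v))"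
    and up: "infinite (block_up u\<^sub>0)"
  shows "\<exists>R\<in>{(\<le>), zeta_le, omega_omega_star_le}.
    (\<exists>e. limit_dense_embedding R e) \<or> (\<exists>e. limit_dense_embedding (\<lambda>m n. R n m) e)"
proof (cases "\<forall>u. infinite (block_up u) \<longrightarrow> (\<exists>t. infinite (block_up t) \<and> far t u)")
  case True
  have "\<exists>f. \<forall>n::nat. infinite (block_up (f n)) \<and> far (f (Suc n)) (f n)"
    by (rule dependent_nat_choice) (use up True in auto)
  then obtain f where "\<And>n::nat. infinite (block_up (f n))" "\<And>n. far (f (Suc n)) (f n)" by blast
  from embedding_omega_omega_star[where u = f, OF this(2,1)] show ?thesis by blast
next
  case False
  then obtain u where u: "infinite (block_up u)"
    and min: "\<And>t. far t u \<Longrightarrow> finite (block_up t)" by blast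
  show ?thesis
  proof (cases "finite {z. z < u}")
    case True
    have "finite {x. x < z}" if "z \<in> block_up u" for z
    proof (rule finite_subset)
      show "{x. x < z} \<subseteq> insert u ({x. x < u} \<union> {x. u < x \<and> x < z})" by auto
      show "finite (insert u ({x. x < u} \<union> {x. u < x \<and> x < z}))"
        using True that by (simp add: block_up_def far_def)
    qed
    then have "block_up u \<subseteq> {z. finite {x. x < z}}" by blast
    with u have "infinite {z. finite {x. x < z}}" by (metis finite_subset)
    from embedding_omega[OF this] show ?thesis by blast
  next
    case below: False
    show ?thesis
    proof (cases "infinite (block_down u)")
      case True
      from embedding_zeta[OF u this] show ?thesis by blast
    next
      case False
      with below have "\<not> {z. z < u} \<subseteq> block_down u" by (metis finite_subset)
      then obtain x where x: "far x u" by (auto simp: block_down_def intro: less_imp_le)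
      \<comment> \<open>Of the two outcomes between \<open>x\<close> and \<open>u\<close>, a block infinite upwards contradicts the choice of \<open>u\<close>. A block
        infinite downwards is not that of \<open>u\<close>, so it is far below \<open>u\<close>.\<close>
      have step: "\<exists>v. infinite (block_down v) \<and> far v u \<and> far x v" if x: "far x u" for x
      proof -
        from between[OF x] obtain t v where
          tv: "x \<le> t" "far t v" "v \<le> u" "infinite (block_up t) \<or> infinite (block_down v)" by blast
        have "far t u" using tv(2,3) far_mono by blast
        with min tv(4) have down: "infinite (block_down v)" by blast
        have "far v u"
        proof (rule ccontr)
          assume "\<not> far v u"
          then have "block_down v \<subseteq> block_down u"
            using tv(3) by (auto simp: block_down_def intro: order_trans dest: not_far_trans)
          with down \<open>\<not> infinite (block_down u)\<close> show False by (metis finite_subset)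
        qed
        moreover have "far x v" using far_mono[OF tv(2) tv(1)] by blast
        ultimately show ?thesis using down by blast
      qed
      have "\<exists>f. \<forall>n::nat. (infinite (block_down (f n)) \<and> far (f n) u) \<and> far (f n) (f (Suc n))"
        by (rule dependent_nat_choice) (use step x in blast)+
      then obtain f where "\<And>n::nat. infinite (block_down (f n))" "\<And>n. far (f n) (f (Suc n))" by blast
      from linorder.embedding_omega_omega_star[OF dual_linorder, unfolded dual_far dual_block_up
          dual_limit_dense_embedding, where u = f, OF this(2,1)]
      show ?thesis by blast
    qed
  qed
qed

text \<open>
  If neither the rationals embed nor any block is infinite on some side, no two points are far, so the
  whole order is a single block, and finite.
\<close>

theorem limit_dense_embedding_exists:
  assumes "infinite (UNIV :: 'a set)"
  shows "\<exists>R\<in>{(\<le>), zeta_le, omega_omega_star_le, eta_le}.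
    (\<exists>e. limit_dense_embedding R e) \<or> (\<exists>e. limit_dense_embedding (\<lambda>m n. R n m) e)"
proof (cases "\<exists>e. limit_dense_embedding eta_le e")
  case False
  note between = infinite_block_between[OF False]
  have "(\<exists>u. infinite (block_up u)) \<or> (\<exists>u. infinite (block_down u))"
  proof (cases "\<exists>x y. far x y")
    case True
    then show ?thesis using between by blast
  next
    case False
    fix x
    have "UNIV = block_up x \<union> block_down x"
      using False linear by (auto simp: block_up_def block_down_def)
    with assms show ?thesis by (metis finite_Un)
  qed
  then show ?thesis
  proof
    assume "\<exists>u. infinite (block_up u)"
    then show ?thesis using limit_dense_embedding_if_block_up[OF between] by blast
  next
    assume "\<exists>u. infinite (block_down u)"
    then obtain u where "infinite (block_down u)" by blast
    then have "\<exists>R\<in>{(\<le>), zeta_le, omega_omega_star_le}.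
      (\<exists>e. limit_dense_embedding (\<lambda>m n. R n m) e) \<or> (\<exists>e. limit_dense_embedding R e)"
    proof (rule linorder.limit_dense_embedding_if_block_up[OF dual_linorder, unfolded dual_far
          dual_block_up dual_block_down dual_limit_dense_embedding, rotated])
      fix x y assume "far y x"
      from between[OF this] show "\<exists>u v. u \<le> x \<and> far v u \<and> y \<le> v \<and>
        (infinite (block_down u) \<or> infinite (block_up v))" by blast
    qed
    then show ?thesis by blast
  qed
qed blast

end

section \<open>Dense decidable sets of natural numbers\<close>

lemma lg_mono: "m \<le> n \<Longrightarrow> lg m \<le> lg n"
  unfolding lg_def by (rule Least_le) (rule le_less_trans[OF _ less_power_Suc_lg[unfolded lg_def]])

text \<open>
  A logarithmic number of omissions is negligible.
\<close>

lemma denseI_lg: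
  assumes "\<And>n. card ({0..n} - D) \<le> lg n + K"
  shows "dense D"
proof -
  let ?c = "\<lambda>n. real (card ({0..n} - D)) / real (n + 1)"
  let ?b = "\<lambda>n. 1 / ln 2 * (ln (real (n + 1)) / real (n + 1)) + real K * (1 / real (n + 1))"
  have at_top: "filterlim (\<lambda>n. real (n + 1)) at_top sequentially"
    by (rule filterlim_compose[OF filterlim_real_sequentially]) (rule filterlim_add_const_nat_at_top)
  have "(\<lambda>n. ln (real (n + 1)) / real (n + 1)) \<longlonglongrightarrow> 0"
    by (rule filterlim_compose[OF ln_x_over_x_tendsto_0 at_top])
  moreover have "(\<lambda>n. 1 / real (n + 1)) \<longlonglongrightarrow> 0"
    by (rule real_tendsto_divide_at_top[OF tendsto_const at_top])
  ultimately have "?b \<longlonglongrightarrow> 1 / ln 2 * 0 + real K * 0"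
    by (intro tendsto_intros)
  then have b: "?b \<longlonglongrightarrow> 0" by simp
  have "?c n \<le> ?b n" for n
  proof -
    have "2 ^ lg n \<le> n + 1" using power_lg_le[of n] by (cases "n = 0") (auto simp: lg_def)
    then have "(2::real) ^ lg n \<le> real (n + 1)"
      by (metis of_nat_le_iff of_nat_numeral of_nat_power)
    then have "ln (2 ^ lg n) \<le> ln (real (n + 1))" by (subst ln_le_cancel_iff) auto
    then have "real (lg n) \<le> 1 / ln 2 * ln (real (n + 1))"
      by (simp add: ln_realpow field_simps)
    moreover have "real (card ({0..n} - D)) \<le> real (lg n) + real K"
      using assms[of n] by (simp flip: of_nat_add)
    ultimately have "real (card ({0..n} - D)) \<le> 1 / ln 2 * ln (real (n + 1)) + real K" by linarith
    then have "?c n \<le> (1 / ln 2 * ln (real (n + 1)) + real K) / real (n + 1)"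
      by (rule divide_right_mono) simp
    then show ?thesis by (simp add: add_divide_distrib)
  qed
  then have "?c \<longlonglongrightarrow> 0"
    by (intro tendsto_sandwich[OF _ _ tendsto_const b]) auto
  then have "(\<lambda>n. 1 - ?c n) \<longlonglongrightarrow> 1 - 0" by (intro tendsto_intros)
  moreover have "1 - ?c n = real (card (D \<inter> {0..n})) / real (n + 1)" for n
  proof -
    have "card {0..n} = card ((D \<inter> {0..n}) \<union> ({0..n} - D))" by (rule arg_cong) auto
    also have "\<dots> = card (D \<inter> {0..n}) + card ({0..n} - D)" by (rule card_Un_disjoint) auto
    finally have "card {0..n} = card (D \<inter> {0..n}) + card ({0..n} - D)" .
    then have "real (n + 1) = real (card (D \<inter> {0..n})) + real (card ({0..n} - D))"
      by (simp flip: of_nat_add)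
    then show ?thesis by (simp add: field_simps)
  qed
  ultimately show ?thesis by (simp add: dense_def)
qed

lemma dense_atLeast: "dense {k..}"
proof (rule denseI_lg)
  fix n
  have "card ({0..n} - {k..}) \<le> card {..<k}" by (intro card_mono) auto
  then show "card ({0..n} - {k..}) \<le> lg n + k" by simp
qed

lemma dense_offset_neq_0: "dense {n. offset n \<noteq> 0}"
proof (rule denseI_lg)
  fix n
  have "{0..n} - {n. offset n \<noteq> 0} \<subseteq> insert 0 ((\<lambda>i. 2 ^ i) ` {..lg n})"
  proof
    fix m assume m: "m \<in> {0..n} - {n. offset n \<noteq> 0}"
    then have "m = 0 \<or> m = 2 ^ lg m" using power_lg_le[of m] by (cases "m = 0") (auto simp: offset_def)
    moreover have "lg m \<le> lg n" using m by (intro lg_mono) simp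
    ultimately show "m \<in> insert 0 ((\<lambda>i. 2 ^ i) ` {..lg n})" by auto
  qed
  then have "card ({0..n} - {n. offset n \<noteq> 0}) \<le> card (insert 0 ((\<lambda>i. 2 ^ i :: nat) ` {..lg n}))"
    by (intro card_mono) auto
  also have "\<dots> \<le> Suc (card ((\<lambda>i. 2 ^ i :: nat) ` {..lg n}))" by (rule card_insert_le_m1) auto
  also have "\<dots> \<le> Suc (card {..lg n})" by (simp only: Suc_le_mono card_image_le finite_atMost)
  finally show "card ({0..n} - {n. offset n \<noteq> 0}) \<le> lg n + 2" by simp
qed

lemma dense_imp_infinite:
  assumes "dense D" shows "infinite D"
proof
  assume fin: "finite D"
  have "(\<lambda>n. real (card (D \<inter> {0..n})) / real (n + 1)) \<longlonglongrightarrow> 0"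
  proof (rule tendsto_sandwich[OF _ _ tendsto_const])
    have at_top: "filterlim (\<lambda>n. real (n + 1)) at_top sequentially"
      by (rule filterlim_compose[OF filterlim_real_sequentially]) (rule filterlim_add_const_nat_at_top)
    show "(\<lambda>n. real (card D) / real (n + 1)) \<longlonglongrightarrow> 0"
      by (rule real_tendsto_divide_at_top[OF tendsto_const at_top])
    show "\<forall>\<^sub>F n in sequentially. real (card (D \<inter> {0..n})) / real (n + 1) \<le> real (card D) / real (n + 1)"
      using fin by (auto intro!: always_eventually divide_right_mono card_mono)
  qed auto
  with assms show False unfolding dense_def using LIMSEQ_unique by fastforce
qed

lemma bij_betw_infinite_nat_sets:
  fixes M N :: "nat set" assumes "infinite M" "infinite N"
  shows "\<exists>f. bij_betw f M N"
  using bij_betw_trans[OF bij_betw_nat_rank(1)[OF assms(1)]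
      bij_betw_inv_into[OF bij_betw_nat_rank(1)[OF assms(2)]]] by blast

text \<open>
  A limit-dense subset may leave over any number of points, and the complement of \<open>D\<close> has to take
  exactly these.
\<close>

lemma dense_decidable_set_with_complement:
  fixes C :: "nat set"
  shows "\<exists>D k. dense D \<and> decidable 1 (\<lambda>xs. xs ! 0 \<in> D) \<and> bij_betw k (- D) C"
proof (cases "finite C")
  case True
  have "- {card C..} = {..<card C}" by auto
  with True have "\<exists>k. bij_betw k (- {card C..}) C" by (intro finite_same_card_bij) auto
  moreover have "decidable 1 (\<lambda>xs. xs ! 0 \<in> {card C..})"
    unfolding atLeast_iff by (intro decidable_le recursive_const recursive_nth) auto
  ultimately show ?thesis using dense_atLeast by blast
next
  case False
  let ?D = "{n. offset n \<noteq> 0}"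
  have "- ?D = {n. offset n = 0}" by auto
  with False have "\<exists>k. bij_betw k (- ?D) C"
    by (intro bij_betw_infinite_nat_sets) (simp_all add: infinite_offset_eq)
  moreover have "decidable 1 (\<lambda>xs. xs ! 0 \<in> ?D)"
    unfolding mem_Collect_eq by (intro decidable_not decidable_offset_eq_0 recursive_nth) auto
  ultimately show ?thesis using dense_offset_neq_0 by blast
qed

section \<open>The copies\<close>

lemma linorder_pullback:
  assumes "class.linorder le lt" "inj g"
  shows "class.linorder (\<lambda>x y. le (g x) (g y)) (\<lambda>x y. lt (g x) (g y))"
proof -
  interpret linorder le lt by (rule assms(1))
  show ?thesis
    using assms(2) by unfold_locales (auto simp: less_le_not_le intro: order_trans injD order_antisym)
qed

lemma limit_dense_pullback:
  assumes "class.linorder le lt" "bij g" "linorder.limit_dense lt (g ` D)"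
  shows "linorder.limit_dense (\<lambda>x y. lt (g x) (g y)) D"
proof -
  have "inj g" using assms(2) by (rule bij_is_inj)
  then have "g y \<notin> g ` D" if "y \<notin> D" for y using that by (simp add: inj_image_mem_iff)
  with assms(3) show ?thesis
    unfolding linorder.limit_dense_def[OF assms(1)]
      linorder.limit_dense_def[OF linorder_pullback[OF assms(1) \<open>inj g\<close>]] by simp
qed

lemma linorder_ordered_sum:
  fixes S :: "nat set"
  assumes "class.linorder le1 lt1" "class.linorder le2 lt2"
  defines "le \<equiv> \<lambda>x y. if x \<in> S then y \<in> S \<longrightarrow> le1 x y else y \<notin> S \<and> le2 x y"
  shows "class.linorder le (\<lambda>x y. le x y \<and> \<not> le y x)"
proof -
  interpret l1: linorder le1 lt1 by (rule assms(1))
  interpret l2: linorder le2 lt2 by (rule assms(2))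
  show ?thesis
  proof unfold_locales
    fix x y z
    show "le x x" by (simp add: le_def)
    show "le x z" if "le x y" "le y z"
      using that l1.order_trans[of x y z] l2.order_trans[of x y z]
      by (auto simp: le_def split: if_splits)
    show "x = y" if "le x y" "le y x"
      using that l1.order_antisym[of x y] l2.order_antisym[of x y]
      by (auto simp: le_def split: if_splits)
    show "le x y \<or> le y x"
      using l1.linear[of x y] l2.linear[of x y] by (auto simp: le_def)
  qed simp
qed

lemma linear_ordering_imp_linorder:
  assumes "linear_ordering L" "univ L = UNIV"
  shows "class.linorder (\<lambda>x y. [x, y] \<in> rl L 0) (\<lambda>x y. [x, y] \<in> rl L 0 \<and> [y, x] \<notin> rl L 0)"
proof -
  have lin: "linear_order {(x, y). [x, y] \<in> rl L 0}"
    using assms by (simp add: linear_ordering_def)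
  show ?thesis
  proof unfold_locales
    fix x y z
    show "[x, x] \<in> rl L 0"
      using lin by (auto simp: order_on_defs refl_on_def)
    show "[x, z] \<in> rl L 0" if "[x, y] \<in> rl L 0" "[y, z] \<in> rl L 0"
      using lin that by (auto simp: order_on_defs dest: transD)
    show "x = y" if "[x, y] \<in> rl L 0" "[y, x] \<in> rl L 0"
      using lin that by (auto simp: order_on_defs dest: antisymD)
    show "[x, y] \<in> rl L 0 \<or> [y, x] \<in> rl L 0"
    proof (cases "x = y")
      case False
      then show ?thesis using lin by (auto simp: order_on_defs total_on_def)
    qed (use \<open>[x, x] \<in> rl L 0\<close> in simp)
  qed simp
qed

text \<open>
  The bijection \<open>g\<close> from numbers to points of \<open>L\<close> sends \<open>D\<close> onto the range of \<open>e\<close>, along the increasing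
  enumeration of \<open>D\<close>, and the complement of \<open>D\<close> onto the remaining points in an arbitrary way. On \<open>D\<close>
  the pulled back order is \<open>R\<close> between ranks, which is decidable.
\<close>

lemma copy_from_limit_dense_embedding:
  assumes L: "univ L = UNIV"
    and lin: "class.linorder (\<lambda>x y. [x, y] \<in> rl L 0) lt"
    and emb: "linorder.limit_dense_embedding (\<lambda>x y. [x, y] \<in> rl L 0) lt R e"
    and R: "decidable 2 (\<lambda>xs. R (xs ! 0) (xs ! 1))"
    and endless: "(\<forall>m. \<exists>n. \<not> R n m) \<or> (\<forall>m. \<exists>n. \<not> R m n)"
  shows "\<exists>A. is_copy order_lang L A \<and> Sigma_generically_ce order_lang (1::nat) A \<and>
    Sigma_coarsely_ce order_lang (1::nat) A"
proof -
  define le where "le = (\<lambda>x y. [x, y] \<in> rl L 0)"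
  interpret lo: linorder le lt unfolding le_def by (rule lin)
  from emb have e: "inj e" "lo.limit_dense (range e)" "\<And>m n. R m n \<longleftrightarrow> le (e m) (e n)"
    unfolding linorder.limit_dense_embedding_def[OF lin] le_def by blast+
  obtain D k where D: "dense D" "decidable 1 (\<lambda>xs. xs ! 0 \<in> D)"
    and k: "bij_betw k (- D) (- range e)"
    using dense_decidable_set_with_complement by blast
  define c where "c = (\<lambda>x. card {d\<in>D. d < x})"
  have c: "bij_betw c D UNIV" unfolding c_def
    by (rule bij_betw_nat_rank(1)) (rule dense_imp_infinite[OF D(1)])
  have rec_c: "recursive 1 (\<lambda>xs. c (xs ! 0))" unfolding c_def by (rule recursive_rank[OF D(2)])
  define g where "g = (\<lambda>x. if x \<in> D then (e \<circ> c) x else k x)"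
  have "bij_betw (e \<circ> c) D (range e)"
    by (rule bij_betw_trans[OF c]) (simp add: bij_betw_def e(1))
  then have gD: "g ` D = range e" by (auto simp: g_def bij_betw_def image_image)
  have bij: "bij g"
  proof -
    have "bij_betw g (D \<union> - D) (range e \<union> - range e)"
    proof (rule bij_betw_combine)
      show "bij_betw g D (range e)"
        using \<open>bij_betw (e \<circ> c) D (range e)\<close> by (rule bij_betw_cong[THEN iffD1, rotated]) (simp add: g_def)
      show "bij_betw g (- D) (- range e)"
        using k by (rule bij_betw_cong[THEN iffD1, rotated]) (simp add: g_def)
    qed auto
    then show ?thesis by simp
  qed
  define le_A where "le_A = (\<lambda>x y. le (g x) (g y))"
  define A where "A = \<lparr>univ = UNIV, fn = (\<lambda>_ _. 0), rl = (\<lambda>_. {[x, y] |x y. le_A x y})\<rparr>"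
  define B where "B = A\<lparr>univ := D\<rparr>"
  have A: "univ A = UNIV" "[x, y] \<in> rl A 0 \<longleftrightarrow> le_A x y" for x y by (simp_all add: A_def)
  have B: "univ B = D" "[x, y] \<in> rl B 0 \<longleftrightarrow> le_A x y" for x y by (simp_all add: B_def A_def)
  have lin_A: "class.linorder le_A (\<lambda>x y. lt (g x) (g y))"
    unfolding le_A_def by (rule linorder_pullback[OF lo.linorder_axioms bij_is_inj[OF bij]])
  have le_D: "le_A x y \<longleftrightarrow> R (c x) (c y)" if "x \<in> D" "y \<in> D" for x y
    using that by (simp add: le_A_def g_def e(3))
  have copy: "is_copy order_lang L A"
  proof -
    have "isomorphism order_lang (inv g) L A"
      unfolding isomorphism_def
    proof (intro conjI allI impI ballI)
      show "bij_betw (inv g) (univ L) (univ A)" using bij by (simp add: L A bij_imp_bij_inv)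
    next
      fix r n xs
      assume "rel_ar order_lang r = Some n" "xs \<in> tuples (univ L) n"
      then have "r = 0" "length xs = 2"
        by (auto simp: order_lang_def tuples_def split: if_splits)
      then obtain x y where "r = 0" "xs = [x, y]"
        by (auto simp: length_Suc_conv numeral_2_eq_2)
      then show "xs \<in> rl L r \<longleftrightarrow> map (inv g) xs \<in> rl A r"
        using bij by (simp add: A le_A_def le_def bij_is_surj surj_f_inv_f)
    qed (simp add: order_lang_def)
    then show ?thesis by (auto simp: is_copy_def is_structure_def order_lang_def A(1))
  qed
  have "lo.limit_dense (g ` D)" unfolding gD by (rule e(2))
  then have elem_A: "Sigma_elementary order_lang (1::nat) B A"
    using lin_A limit_dense_pullback[OF lo.linorder_axioms bij]
    by (intro limit_dense_imp_Sigma_1_elementary[where lt = "\<lambda>x y. lt (g x) (g y)"])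
      (simp_all add: A B)
  have rec_R: "decidable 2 (\<lambda>xs. R (c (xs ! 0)) (c (xs ! 1)))"
    by (intro decidable_subst2[OF R] recursive_subst1[OF rec_c] recursive_nth) auto
  have ce_B: "ce_set D" "ce_structure order_lang B"
    using decidable_imp_ce_order[of B, OF _ rec_R] D(2) by (simp_all add: B le_D)
  have generic: "Sigma_generically_ce order_lang (1::nat) A"
    unfolding Sigma_generically_ce_def using D(1) ce_B elem_A unfolding B_def by blast
  have coarse: "Sigma_coarsely_ce order_lang (1::nat) A"
  proof -
    define up where "up \<longleftrightarrow> (\<forall>m. \<exists>n. \<not> R n m)"
    \<comment> \<open>The complement of \<open>D\<close> goes to an end at which \<open>R\<close> has no extreme element, so that its points are
      limits of \<open>D\<close>.\<close>
    define le_E where "le_E = (\<lambda>x y.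
      if up
      then (if x \<in> D then y \<in> D \<longrightarrow> le_A x y else y \<notin> D \<and> x \<le> y)
      else (if x \<in> - D then y \<in> - D \<longrightarrow> x \<le> y else y \<notin> - D \<and> le_A x y))"
    define lt_E where "lt_E = (\<lambda>x y. le_E x y \<and> \<not> le_E y x)"
    define E where "E = \<lparr>univ = UNIV, fn = (\<lambda>_ _. 0), rl = (\<lambda>_. {[x, y] |x y. le_E x y})\<rparr>"
    have E: "univ E = UNIV" "[x, y] \<in> rl E 0 \<longleftrightarrow> le_E x y" for x y by (simp_all add: E_def)
    have le_E_up: "le_E = (\<lambda>x y. if x \<in> D then y \<in> D \<longrightarrow> le_A x y else y \<notin> D \<and> x \<le> y)" if up
      using that by (simp add: le_E_def)
    have le_E_down: "le_E = (\<lambda>x y. if x \<in> - D then y \<in> - D \<longrightarrow> x \<le> y else y \<notin> - D \<and> le_A x y)"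
      if "\<not> up" using that by (simp add: le_E_def)
    have lin_E: "class.linorder le_E lt_E"
    proof (cases up)
      case True
      show ?thesis unfolding lt_E_def le_E_up[OF True]
        by (rule linorder_ordered_sum[OF lin_A linorder_class.linorder_axioms])
    next
      case False
      show ?thesis unfolding lt_E_def le_E_down[OF False]
        by (rule linorder_ordered_sum[OF linorder_class.linorder_axioms lin_A])
    qed
    have surj_c: "\<exists>d\<in>D. c d = n" for n using c by (metis UNIV_I bij_betw_imp_surj_on imageE)
    interpret lA: linorder le_A "\<lambda>x y. lt (g x) (g y)" by (rule lin_A)
    have "linorder.limit_dense lt_E D"
      unfolding linorder.limit_dense_def[OF lin_E]
    proof (intro allI impI)
      fix y assume y: "y \<notin> D"
      show "(\<exists>d\<in>D. lt_E d y) \<and> (\<forall>a\<in>D. lt_E a y \<longrightarrow> (\<exists>d\<in>D. lt_E a d \<and> lt_E d y)) \<or>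
        (\<exists>d\<in>D. lt_E y d) \<and> (\<forall>a\<in>D. lt_E y a \<longrightarrow> (\<exists>d\<in>D. lt_E y d \<and> lt_E d a))"
      proof (cases up)
        case True
        have below: "lt_E d y" if "d \<in> D" for d using True that y by (simp add: lt_E_def le_E_def)
        have "\<exists>d\<in>D. lt_E a d" if a: "a \<in> D" for a
        proof -
          from True surj_c obtain d where "d \<in> D" "\<not> R (c d) (c a)" unfolding up_def by metis
          with a True le_D[of d a] lA.linear[of a d] show ?thesis
            by (intro bexI[of _ d]) (auto simp: lt_E_def le_E_def)
        qed
        with below surj_c show ?thesis by blast
      next
        case False
        then have False': "\<forall>m. \<exists>n. \<not> R m n" using endless up_def by blast
        have above: "lt_E y d" if "d \<in> D" for d using False that y by (simp add: lt_E_def le_E_def)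
        have "\<exists>d\<in>D. lt_E d a" if a: "a \<in> D" for a
        proof -
          from False' surj_c obtain d where "d \<in> D" "\<not> R (c a) (c d)" by metis
          with a False le_D[of a d] lA.linear[of d a] show ?thesis
            by (intro bexI[of _ d]) (auto simp: lt_E_def le_E_def)
        qed
        with above surj_c show ?thesis by blast
      qed
    qed
    then have elem_E: "Sigma_elementary order_lang (1::nat) B E"
      using lin_E
      by (intro limit_dense_imp_Sigma_1_elementary[where lt = lt_E]) (auto simp: B E le_E_def)
    \<comment> \<open>The same relation, written so that its decidability can be read off.\<close>
    define Q where "Q = (\<lambda>x y.
      x \<in> D \<and> (y \<in> D \<and> R (c x) (c y)) \<or>
      x \<notin> D \<and> (y \<notin> D \<and> x \<le> y) \<or>
      up \<and> (x \<in> D \<and> y \<notin> D) \<or>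
      \<not> up \<and> (x \<notin> D \<and> y \<in> D))"
    have "le_E x y \<longleftrightarrow> Q x y" for x y using le_D[of x y] by (auto simp: le_E_def Q_def)
    moreover have "decidable 2 (\<lambda>xs. Q (xs ! 0) (xs ! 1))" unfolding Q_def
      by (intro decidable_disj decidable_conj decidable_not decidable_const decidable_nat_le rec_R
          decidable_subst1[OF D(2)] recursive_nth) auto
    ultimately have "ce_structure order_lang E"
      by (intro decidable_imp_ce_order(2)[of E Q]) (simp_all add: E decidable_const)
    with D(1) elem_A elem_E show ?thesis
      unfolding Sigma_coarsely_ce_def by (intro exI[of _ D] exI[of _ E] exI[of _ B]) (simp add: E B)
  qed
  from copy generic coarse show ?thesis by blast
qed

theorem theorem3p5:
  fixes L :: struct
  assumes "linear_ordering L" and "univ L = UNIV"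
  shows "(\<exists>A. is_copy order_lang L A \<and> Sigma_generically_ce order_lang (1::nat) A) \<and>
         (\<exists>A. is_copy order_lang L A \<and> Sigma_coarsely_ce order_lang (1::nat) A)"
proof -
  note lin = linear_ordering_imp_linorder[OF assms]
  from linorder.limit_dense_embedding_exists[OF lin infinite_UNIV_nat] obtain R e where
    R: "R \<in> {(\<le>), zeta_le, omega_omega_star_le, eta_le}" and
    e: "linorder.limit_dense_embedding (\<lambda>x y. [x, y] \<in> rl L 0)
          (\<lambda>x y. [x, y] \<in> rl L 0 \<and> [y, x] \<notin> rl L 0) R e \<or>
        linorder.limit_dense_embedding (\<lambda>x y. [x, y] \<in> rl L 0)
          (\<lambda>x y. [x, y] \<in> rl L 0 \<and> [y, x] \<notin> rl L 0) (\<lambda>m n. R n m) e"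
    by blast
  have dec: "decidable 2 (\<lambda>xs. R (xs ! 0) (xs ! 1))"
    using R decidable_nat_le decidable_zeta_le decidable_omega_omega_star_le decidable_eta_le
    by blast
  then have dec': "decidable 2 (\<lambda>xs. R (xs ! 1) (xs ! 0))"
    by (rule decidable_subst2) (auto intro: recursive_nth)
  have "\<exists>A. is_copy order_lang L A \<and> Sigma_generically_ce order_lang (1::nat) A \<and>
    Sigma_coarsely_ce order_lang (1::nat) A"
    using e
  proof
    assume "linorder.limit_dense_embedding (\<lambda>x y. [x, y] \<in> rl L 0)
          (\<lambda>x y. [x, y] \<in> rl L 0 \<and> [y, x] \<notin> rl L 0) R e"
    from copy_from_limit_dense_embedding[OF assms(2) lin this dec] no_greatest[OF R]
    show ?thesis by blast
  next
    assume "linorder.limit_dense_embedding (\<lambda>x y. [x, y] \<in> rl L 0)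
          (\<lambda>x y. [x, y] \<in> rl L 0 \<and> [y, x] \<notin> rl L 0) (\<lambda>m n. R n m) e"
    from copy_from_limit_dense_embedding[OF assms(2) lin this dec'] no_greatest[OF R]
    show ?thesis by blast
  qed
  then show ?thesis by blast
qed

end
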